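(* (The snake lemma) Let $\mathcal{C}$ be a weakly exact category and let $$\begin{array}{ccccc} A_1 & \xrightarrow{\phi_1} & A_2 & \xrightarrow{\phi_2} & A_3\\ {\scriptstyle f_1}\downarrow & & {\scriptstyle f_2}\downarrow & & \downarrow{\scriptstyle f_3}\\ B_1 & \xrightarrow{\phi_1'} & B_2 & \xrightarrow{\phi_2'} & B_3 \end{array}$$ be a commutative diagram in $\mathcal{C}$ whose two rows are short exact and in which $f_1,f_2,f_3$ are admissible, i.e. for each $i$ there is a factorization $f_i = f_i'' f_i'$, $A_i\xrightarrow{f_i'} I_i\xrightarrow{f_i''} B_i$, with $f_i'$ a deflation with kernel $k_i:K_i\to A_i$ and $f_i''$ an inflation with cokernel $c_i:B_i\to C_i$. Let $\psi_i:K_i\to K_{i+1}$ and $\psi_i':C_i\to C_{i+1}$ ($i=1,2$) be the morphisms induced by $\phi_i$ and $\phi_i'$ via the universal properties of kernel and cokernel. Then there is a natural connecting morphism $\delta:K_3\to C_1$ such that the sequence $$K_1\xrightarrow{\psi_1}K_2\xrightarrow{\psi_2}K_3\xrightarrow{\delta}C_1\xrightarrow{\psi_1'}C_2\xrightarrow{\psi_2'}C_3$$ is exact, and moreover $\psi_1$ is an inflation and $\psi_2'$ is a deflation. Here natural means: given a second diagram of the same kind (with objects $\tilde A_i,\tilde B_i$, admissible vertical morphisms, and connecting morphism $\tilde\delta:\tilde K_3\to\tilde C_1$) and morphisms $A_i\to\tilde A_i$, $B_i\to\tilde B_i$ making all squares commute, the composites $K_3\xrightarrow{\delta}C_1\to\tilde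 C_1$ and $K_3\to\tilde K_3\xrightarrow{\tilde\delta}\tilde C_1$ are equal, where $K_3\to\tilde K_3$ and $C_1\to\tilde C_1$ are the induced morphisms.
   Context: A weakly exact category is a category with a zero object together with a class of morphisms called deflations, satisfying: (0) every isomorphism and every morphism $A\to 0$ is a deflation; (1) every deflation has a kernel and is a cokernel of its kernel; (2) deflations are closed under composition; (3) for composable morphisms $f,g$, if $gf$ and $f$ are deflations then $g$ is a deflation; (4) for every commutative $3\times3$ diagram with rows $A_1\to A_2\to A_3$, $B_1\to B_2\to B_3$, $C_1\to C_2\to C_3$ and columns $A_i\to B_i\to C_i$ ($i=1,2,3$), if all three columns and the second and third rows are short exact, then the first row is short exact. Here a sequence $A\xrightarrow{i}B\xrightarrow{p}C$ is called short exact if $p$ is a deflation and $i$ is a kernel of $p$ (so $p$ is also a cokernel of $i$). A kernel of a deflation is called an inflation. Exact sequences: a sequence $X_1\to X_2\to\dots\to X_n$ is exact if there are objects $Z_1,\dots,Z_{n+1}$ and short exact sequences $Z_i\to X_i\to Z_{i+1}$ ($1\le i\le n$) such that each morphism $X_i\to X_{i+1}$ ($1\le i<n$) equals the composite $X_i\to Z_{i+1}\to X_{i+1}$. *)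

theory Defs
  imports Main
begin

record ('o, 'm) category =
  Obj :: "'o set"
  Mor :: "'m set"
  Dom :: "'m \<Rightarrow> 'o"
  Cod :: "'m \<Rightarrow> 'o"
  Id :: "'o \<Rightarrow> 'm"
  Comp :: "'m \<Rightarrow> 'm \<Rightarrow> 'm"  (infixl "\<cdot>\<index>" 70)

text \<open>The composite \<open>g \<cdot> f\<close> means ``first \<open>f\<close>, then \<open>g\<close>'' and is unspecified unless
  the codomain of \<open>f\<close> is the domain of \<open>g\<close>.\<close>

definition Hom :: "('o, 'm, 'z) category_scheme \<Rightarrow> 'o \<Rightarrow> 'o \<Rightarrow> 'm set"
  where "Hom C X Y = {f \<in> Mor C. Dom C f = X \<and> Cod C f = Y}"

locale category =
  fixes C :: "('o, 'm, 'z) category_scheme" (structure)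
  assumes Dom_Obj: "f \<in> Mor C \<Longrightarrow> Dom C f \<in> Obj C"
    and Cod_Obj: "f \<in> Mor C \<Longrightarrow> Cod C f \<in> Obj C"
    and Id_Hom: "X \<in> Obj C \<Longrightarrow> Id C X \<in> Hom C X X"
    and Comp_Hom: "\<lbrakk>f \<in> Hom C X Y; g \<in> Hom C Y Z\<rbrakk> \<Longrightarrow> g \<cdot> f \<in> Hom C X Z"
    and Comp_Id_right: "f \<in> Hom C X Y \<Longrightarrow> f \<cdot> Id C X = f"
    and Comp_Id_left: "f \<in> Hom C X Y \<Longrightarrow> Id C Y \<cdot> f = f"
    and Comp_assoc: "\<lbrakk>f \<in> Hom C W X; g \<in> Hom C X Y; h \<in> Hom C Y Z\<rbrakk>
      \<Longrightarrow> (h \<cdot> g) \<cdot> f = h \<cdot> (g \<cdot> f)"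

definition is_iso :: "('o, 'm, 'z) category_scheme \<Rightarrow> 'm \<Rightarrow> bool"
  where "is_iso C f \<longleftrightarrow> f \<in> Mor C \<and>
    (\<exists>g \<in> Hom C (Cod C f) (Dom C f).
      g \<cdot>\<^bsub>C\<^esub> f = Id C (Dom C f) \<and> f \<cdot>\<^bsub>C\<^esub> g = Id C (Cod C f))"

definition zero_object :: "('o, 'm, 'z) category_scheme \<Rightarrow> 'o \<Rightarrow> bool"
  where "zero_object C Z \<longleftrightarrow> Z \<in> Obj C \<and>
    (\<forall>X \<in> Obj C. (\<exists>!f. f \<in> Hom C X Z) \<and> (\<exists>!f. f \<in> Hom C Z X))"

definition zero_morphism :: "('o, 'm, 'z) category_scheme \<Rightarrow> 'm \<Rightarrow> bool"
  where "zero_morphism C f \<longleftrightarrow> f \<in> Mor C \<and>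
    (\<exists>Z g h. zero_object C Z \<and> g \<in> Hom C (Dom C f) Z \<and> h \<in> Hom C Z (Cod C f) \<and>
      f = h \<cdot>\<^bsub>C\<^esub> g)"

text \<open>\<open>is_kernel C k f\<close>: \<open>k\<close> is a kernel of \<open>f\<close>; \<open>is_cokernel C c f\<close>: \<open>c\<close> is a cokernel
  of \<open>f\<close>.\<close>

definition is_kernel :: "('o, 'm, 'z) category_scheme \<Rightarrow> 'm \<Rightarrow> 'm \<Rightarrow> bool"
  where "is_kernel C k f \<longleftrightarrow> k \<in> Mor C \<and> f \<in> Mor C \<and> Cod C k = Dom C f \<and>
    zero_morphism C (f \<cdot>\<^bsub>C\<^esub> k) \<and>
    (\<forall>h \<in> Mor C. Cod C h = Dom C f \<and> zero_morphism C (f \<cdot>\<^bsub>C\<^esub> h) \<longrightarrow>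
      (\<exists>!u. u \<in> Hom C (Dom C h) (Dom C k) \<and> k \<cdot>\<^bsub>C\<^esub> u = h))"

definition is_cokernel :: "('o, 'm, 'z) category_scheme \<Rightarrow> 'm \<Rightarrow> 'm \<Rightarrow> bool"
  where "is_cokernel C c f \<longleftrightarrow> c \<in> Mor C \<and> f \<in> Mor C \<and> Dom C c = Cod C f \<and>
    zero_morphism C (c \<cdot>\<^bsub>C\<^esub> f) \<and>
    (\<forall>h \<in> Mor C. Dom C h = Cod C f \<and> zero_morphism C (h \<cdot>\<^bsub>C\<^esub> f) \<longrightarrow>
      (\<exists>!u. u \<in> Hom C (Cod C c) (Cod C h) \<and> u \<cdot>\<^bsub>C\<^esub> c = h))"

text \<open>\<open>comm_square C t l r b\<close> is the commutative square with top side \<open>t\<close>, left side \<open>l\<close>,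
  right side \<open>r\<close> and bottom side \<open>b\<close>, the horizontal arrows pointing right and the vertical
  ones pointing down.\<close>

definition comm_square :: "('o, 'm, 'z) category_scheme \<Rightarrow> 'm \<Rightarrow> 'm \<Rightarrow> 'm \<Rightarrow> 'm \<Rightarrow> bool"
  where "comm_square C t l r b \<longleftrightarrow>
    t \<in> Mor C \<and> l \<in> Mor C \<and> r \<in> Mor C \<and> b \<in> Mor C \<and>
    Dom C t = Dom C l \<and> Cod C t = Dom C r \<and> Cod C l = Dom C b \<and> Cod C r = Cod C b \<and>
    r \<cdot>\<^bsub>C\<^esub> t = b \<cdot>\<^bsub>C\<^esub> l"

record ('o, 'm) deflation_category = "('o, 'm) category" +
  Defl :: "'m set"

definition short_exact :: "('o, 'm, 'z) deflation_category_scheme \<Rightarrow> 'm \<Rightarrow> 'm \<Rightarrow> bool"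
  where "short_exact C i p \<longleftrightarrow> p \<in> Defl C \<and> is_kernel C i p"

definition inflation :: "('o, 'm, 'z) deflation_category_scheme \<Rightarrow> 'm \<Rightarrow> bool"
  where "inflation C i \<longleftrightarrow> (\<exists>p \<in> Defl C. is_kernel C i p)"

text \<open>In \<open>three_by_three\<close> the rows are \<open>a1, a2\<close>, \<open>b1, b2\<close> and \<open>c1, c2\<close> (top to
  bottom), and the columns are \<open>u1, v1\<close>, \<open>u2, v2\<close> and \<open>u3, v3\<close> (left to right).\<close>

locale weakly_exact_category = category C
  for C :: "('o, 'm, 'z) deflation_category_scheme" (structure) +
  assumes zero_object_exists: "\<exists>Z. zero_object C Z"
    and Defl_Mor: "Defl C \<subseteq> Mor C"
    and iso_Defl: "is_iso C f \<Longrightarrow> f \<in> Defl C"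
    and to_zero_Defl: "\<lbrakk>zero_object C Z; f \<in> Hom C X Z\<rbrakk> \<Longrightarrow> f \<in> Defl C"
    and Defl_has_kernel: "p \<in> Defl C \<Longrightarrow> \<exists>i. is_kernel C i p"
    and Defl_is_cokernel: "\<lbrakk>p \<in> Defl C; is_kernel C i p\<rbrakk> \<Longrightarrow> is_cokernel C p i"
    and Defl_Comp: "\<lbrakk>f \<in> Defl C; g \<in> Defl C; Cod C f = Dom C g\<rbrakk> \<Longrightarrow> g \<cdot> f \<in> Defl C"
    and Defl_cancel: "\<lbrakk>f \<in> Mor C; g \<in> Mor C; Cod C f = Dom C g; g \<cdot> f \<in> Defl C; f \<in> Defl C\<rbrakk>
      \<Longrightarrow> g \<in> Defl C"
    and three_by_three:
      "\<lbrakk>comm_square C a1 u1 u2 b1; comm_square C a2 u2 u3 b2;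
        comm_square C b1 v1 v2 c1; comm_square C b2 v2 v3 c2;
        short_exact C u1 v1; short_exact C u2 v2; short_exact C u3 v3;
        short_exact C b1 b2; short_exact C c1 c2\<rbrakk>
      \<Longrightarrow> short_exact C a1 a2"

text \<open>Lists are indexed from 0: the objects \<open>Z 0, \<dots>, Z n\<close> below play the role of
  \<open>Z\<^sub>1, \<dots>, Z\<^sub>n\<^sub>+\<^sub>1\<close> for the sequence of \<open>n\<close> objects \<open>Xs\<close> connected by the
  morphisms \<open>fs\<close>.\<close>

definition exact_sequence ::
  "('o, 'm, 'z) deflation_category_scheme \<Rightarrow> 'o list \<Rightarrow> 'm list \<Rightarrow> bool"
  where "exact_sequence C Xs fs \<longleftrightarrow> length Xs = Suc (length fs) \<and>
    (\<exists>(Z :: nat \<Rightarrow> 'o) i p.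
      (\<forall>j < length Xs. i j \<in> Hom C (Z j) (Xs ! j) \<and> p j \<in> Hom C (Xs ! j) (Z (Suc j)) \<and>
        short_exact C (i j) (p j)) \<and>
      (\<forall>j < length fs. fs ! j = i (Suc j) \<cdot>\<^bsub>C\<^esub> p j))"

text \<open>Only the values at 1, 2 (horizontal arrows) and at 1, 2, 3 (the other fields) are
  relevant.\<close>

record 'm snake_diagram =
  top_row :: "nat \<Rightarrow> 'm"      \<comment> \<open>\<open>\<phi>\<^sub>i : A\<^sub>i \<rightarrow> A\<^sub>i\<^sub>+\<^sub>1\<close>\<close>
  bottom_row :: "nat \<Rightarrow> 'm"   \<comment> \<open>\<open>\<phi>'\<^sub>i : B\<^sub>i \<rightarrow> B\<^sub>i\<^sub>+\<^sub>1\<close>\<close>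
  vert :: "nat \<Rightarrow> 'm"         \<comment> \<open>\<open>f\<^sub>i : A\<^sub>i \<rightarrow> B\<^sub>i\<close>\<close>
  defl_part :: "nat \<Rightarrow> 'm"    \<comment> \<open>\<open>f'\<^sub>i : A\<^sub>i \<rightarrow> I\<^sub>i\<close>\<close>
  infl_part :: "nat \<Rightarrow> 'm"    \<comment> \<open>\<open>f''\<^sub>i : I\<^sub>i \<rightarrow> B\<^sub>i\<close>\<close>
  ker_arr :: "nat \<Rightarrow> 'm"      \<comment> \<open>\<open>k\<^sub>i : K\<^sub>i \<rightarrow> A\<^sub>i\<close>\<close>
  coker_arr :: "nat \<Rightarrow> 'm"    \<comment> \<open>\<open>c\<^sub>i : B\<^sub>i \<rightarrow> C\<^sub>i\<close>\<close>

definition snake ::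
  "('o, 'm, 'z) deflation_category_scheme \<Rightarrow> 'm snake_diagram \<Rightarrow> bool"
  where "snake C D \<longleftrightarrow>
    comm_square C (top_row D 1) (vert D 1) (vert D 2) (bottom_row D 1) \<and>
    comm_square C (top_row D 2) (vert D 2) (vert D 3) (bottom_row D 2) \<and>
    short_exact C (top_row D 1) (top_row D 2) \<and>
    short_exact C (bottom_row D 1) (bottom_row D 2) \<and>
    (\<forall>i \<in> {1, 2, 3}.
      defl_part D i \<in> Defl C \<and> inflation C (infl_part D i) \<and>
      Cod C (defl_part D i) = Dom C (infl_part D i) \<and>
      vert D i = infl_part D i \<cdot>\<^bsub>C\<^esub> defl_part D i \<and>
      is_kernel C (ker_arr D i) (defl_part D i) \<and>
      is_cokernel C (coker_arr D i) (infl_part D i))"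

text \<open>For kernels \<open>k : K \<rightarrow> A\<close> and \<open>k' : K' \<rightarrow> A'\<close>, the morphism \<open>K \<rightarrow> K'\<close> induced by
  \<open>a : A \<rightarrow> A'\<close>; dually for cokernels.\<close>

definition ker_map :: "('o, 'm, 'z) category_scheme \<Rightarrow> 'm \<Rightarrow> 'm \<Rightarrow> 'm \<Rightarrow> 'm"
  where "ker_map C k k' a =
    (THE u. u \<in> Hom C (Dom C k) (Dom C k') \<and> k' \<cdot>\<^bsub>C\<^esub> u = a \<cdot>\<^bsub>C\<^esub> k)"

definition coker_map :: "('o, 'm, 'z) category_scheme \<Rightarrow> 'm \<Rightarrow> 'm \<Rightarrow> 'm \<Rightarrow> 'm"
  where "coker_map C c c' b =
    (THE u. u \<in> Hom C (Cod C c) (Cod C c') \<and> u \<cdot>\<^bsub>C\<^esub> c = c' \<cdot>\<^bsub>C\<^esub> b)"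

definition snake_psi ::
  "('o, 'm, 'z) category_scheme \<Rightarrow> 'm snake_diagram \<Rightarrow> nat \<Rightarrow> 'm"
  where "snake_psi C D i = ker_map C (ker_arr D i) (ker_arr D (Suc i)) (top_row D i)"

definition snake_psi' ::
  "('o, 'm, 'z) category_scheme \<Rightarrow> 'm snake_diagram \<Rightarrow> nat \<Rightarrow> 'm"
  where "snake_psi' C D i = coker_map C (coker_arr D i) (coker_arr D (Suc i)) (bottom_row D i)"

text \<open>A morphism of diagrams has components \<open>a i : A\<^sub>i \<rightarrow> A'\<^sub>i\<close> and \<open>b i : B\<^sub>i \<rightarrow> B'\<^sub>i\<close>; no
  compatibility with the chosen factorizations is assumed.\<close>

definition snake_morphism ::
  "('o, 'm, 'z) category_scheme \<Rightarrow> 'm snake_diagram \<Rightarrow> 'm snake_diagram \<Rightarrow>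
    (nat \<Rightarrow> 'm) \<Rightarrow> (nat \<Rightarrow> 'm) \<Rightarrow> bool"
  where "snake_morphism C D D' a b \<longleftrightarrow>
    (\<forall>i \<in> {1, 2}. comm_square C (top_row D i) (a i) (a (Suc i)) (top_row D' i)) \<and>
    (\<forall>i \<in> {1, 2}. comm_square C (bottom_row D i) (b i) (b (Suc i)) (bottom_row D' i)) \<and>
    (\<forall>i \<in> {1, 2, 3}. comm_square C (vert D i) (a i) (b i) (vert D' i))"

end

theory Submission
  imports Defs
begin

text \<open>
  There are neither elements nor pullbacks to chase with, and inflations need not compose (think
  of normal subgroups of groups). The diagram is instead cut into short exact sequences, and every
  step is an instance of one of two consequences of the three-by-three axiom. The first,
  \<open>kernels_of_composite_ses\<close>, is the short exact sequence
  \<open>ker p \<rightarrow> ker (q \<cdot> p) \<rightarrow> ker q\<close> of two composable deflations. The second,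
  \<open>diamond_ses\<close>, is a second isomorphism theorem: if \<open>A\<close> and \<open>B\<close> are kernels of deflations on
  \<open>P\<close> and \<open>A \<rightarrow> P/B\<close> is a deflation, then \<open>B \<rightarrow> P/A\<close> is a deflation with the same kernel.

  The images \<open>I\<^sub>1 \<rightarrow> I\<^sub>2 \<rightarrow> I\<^sub>3\<close> of the vertical morphisms form a sequence that can fail to be short
  exact only in the middle. Let \<open>J\<close> be the kernel of \<open>I\<^sub>2 \<rightarrow> I\<^sub>3\<close>; then \<open>I\<^sub>1 \<rightarrow> J\<close> has a cokernel
  \<open>Q\<close>, the homology of the sequence of images, and \<open>Q\<close> is the image of the connecting morphism. On the
  side of the cokernels (\<open>cokernel_side\<close>), \<open>J\<close> embeds in \<open>B\<^sub>1\<close>, as the intersection of \<open>I\<^sub>2\<close> and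
  \<open>B\<^sub>1\<close> inside \<open>B\<^sub>2\<close>, and \<open>Q\<close> is the kernel of \<open>C\<^sub>1 \<rightarrow> C\<^sub>2\<close>. On the side of the kernels
  (\<open>kernel_side\<close>), the kernel \<open>L\<close> of \<open>A\<^sub>2 \<rightarrow> I\<^sub>3\<close> maps onto \<open>K\<^sub>3\<close> and onto \<open>J\<close>, and \<open>Q\<close> is the
  cokernel of \<open>K\<^sub>2 \<rightarrow> K\<^sub>3\<close>. The connecting morphism is the composite \<open>K\<^sub>3 \<rightarrow> Q \<rightarrow> C\<^sub>1\<close>.

  After composition with the epimorphism \<open>L \<rightarrow> K\<^sub>3\<close> it becomes \<open>L \<rightarrow> B\<^sub>1 \<rightarrow> C\<^sub>1\<close>, where
  \<open>L \<rightarrow> B\<^sub>1\<close> is the unique factorization of \<open>L \<rightarrow> A\<^sub>2 \<rightarrow> B\<^sub>2\<close> through \<open>B\<^sub>1 \<rightarrow> B\<^sub>2\<close>. This is the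
  usual recipe of the snake lemma, and as \<open>L\<close> and \<open>L \<rightarrow> B\<^sub>1\<close> are functorial in the diagram it gives
  naturality.
\<close>

section \<open>Composition and zero morphisms\<close>

context category
begin

lemma HomD:
  assumes "f \<in> Hom C X Y"
  shows "f \<in> Mor C" "Dom C f = X" "Cod C f = Y" "X \<in> Obj C" "Y \<in> Obj C"
  using assms Dom_Obj Cod_Obj by (auto simp: Hom_def)

lemma HomI: "\<lbrakk>f \<in> Mor C; Dom C f = X; Cod C f = Y\<rbrakk> \<Longrightarrow> f \<in> Hom C X Y"
  by (simp add: Hom_def)

text \<open>The rules for composites are repeated with separate equations for domains and codomains: as
  conditional rewrite rules with equational side conditions they let the simplifier bring composites
  of arrows of known type into right-nested form.\<close>

lemma Comp_Mor:
  assumes "f \<in> Mor C" "g \<in> Mor C" "Cod C f = Dom C g"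
  shows "g \<cdot> f \<in> Mor C" "Dom C (g \<cdot> f) = Dom C f" "Cod C (g \<cdot> f) = Cod C g"
  using HomD(1-3)[OF Comp_Hom[OF HomI HomI]] assms by auto

lemma Comp_assoc_Mor:
  "\<lbrakk>f \<in> Mor C; g \<in> Mor C; h \<in> Mor C; Cod C f = Dom C g; Cod C g = Dom C h\<rbrakk>
    \<Longrightarrow> (h \<cdot> g) \<cdot> f = h \<cdot> (g \<cdot> f)"
  by (rule Comp_assoc[OF HomI HomI HomI]) auto

lemmas comp_simps = Hom_def Comp_Mor Comp_assoc_Mor

text \<open>Once composites are nested to the right, an equation \<open>g \<cdot> f = r\<close> no longer matches inside
  \<open>g \<cdot> (f \<cdot> x)\<close>; this is its form that does.\<close>

lemma comp_extend:
  assumes "g \<cdot> f = r" "f \<in> Hom C X Y" "g \<in> Hom C Y Z" "x \<in> Mor C" "Cod C x = X"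
  shows "g \<cdot> (f \<cdot> x) = r \<cdot> x"
  using assms by (auto simp: comp_simps)

lemma zero_object_unique:
  assumes "zero_object C Z" "X \<in> Obj C"
  shows "\<exists>!f. f \<in> Hom C X Z" "\<exists>!f. f \<in> Hom C Z X"
  using assms by (simp_all add: zero_object_def)

lemma to_zero_object_eq:
  "\<lbrakk>zero_object C Z; f \<in> Hom C X Z; g \<in> Hom C X Z\<rbrakk> \<Longrightarrow> f = g"
  using zero_object_unique(1)[OF _ HomD(4)] by metis

lemma from_zero_object_eq:
  "\<lbrakk>zero_object C Z; f \<in> Hom C Z X; g \<in> Hom C Z X\<rbrakk> \<Longrightarrow> f = g"
  using zero_object_unique(2)[OF _ HomD(5)] by metis

lemma zero_morphismE:
  assumes "zero_morphism C f" "f \<in> Hom C X Y"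
  obtains Z g h where "zero_object C Z" "g \<in> Hom C X Z" "h \<in> Hom C Z Y" "f = h \<cdot> g"
  using assms unfolding zero_morphism_def by (auto simp: Hom_def)

lemma zero_morphismI:
  assumes "zero_object C Z" "g \<in> Hom C X Z" "h \<in> Hom C Z Y"
  shows "zero_morphism C (h \<cdot> g)"
  using assms Comp_Hom[OF assms(2,3)] HomD[OF Comp_Hom[OF assms(2,3)]]
  unfolding zero_morphism_def by blast

text \<open>The two zero objects through which \<open>f\<close> and \<open>f'\<close> factor may differ, but the unique arrow
  between them identifies the two factorizations.\<close>

lemma zero_morphism_unique:
  assumes "zero_morphism C f" "zero_morphism C f'" "f \<in> Hom C X Y" "f' \<in> Hom C X Y"
  shows "f = f'"
proof -
  obtain Z g h where Z: "zero_object C Z" "g \<in> Hom C X Z" "h \<in> Hom C Z Y" "f = h \<cdot> g"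
    using zero_morphismE[OF assms(1,3)] .
  obtain Z' g' h' where Z': "zero_object C Z'" "g' \<in> Hom C X Z'" "h' \<in> Hom C Z' Y" "f' = h' \<cdot> g'"
    using zero_morphismE[OF assms(2,4)] .
  obtain z where z: "z \<in> Hom C Z Z'"
    using zero_object_unique(1)[OF Z'(1) HomD(4)[OF Z(3)]] by blast
  have "h' \<cdot> z = h"
    using from_zero_object_eq[OF Z(1) Comp_Hom[OF z Z'(3)] Z(3)] .
  moreover have "z \<cdot> g = g'"
    using to_zero_object_eq[OF Z'(1) Comp_Hom[OF Z(2) z] Z'(2)] .
  ultimately show ?thesis
    using Z(4) Z'(4) Comp_assoc[OF Z(2) z Z'(3)] by simp
qed

lemma zero_comp_right:
  assumes "zero_morphism C f" "f \<in> Hom C X Y" "g \<in> Hom C Y Z"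
  shows "zero_morphism C (g \<cdot> f)"
proof -
  obtain W a b where W: "zero_object C W" "a \<in> Hom C X W" "b \<in> Hom C W Y" "f = b \<cdot> a"
    using zero_morphismE[OF assms(1,2)] .
  then show ?thesis
    using zero_morphismI[OF W(1,2) Comp_Hom[OF W(3) assms(3)]] Comp_assoc assms(3) by metis
qed

lemma zero_comp_left:
  assumes "zero_morphism C g" "f \<in> Hom C X Y" "g \<in> Hom C Y Z"
  shows "zero_morphism C (g \<cdot> f)"
proof -
  obtain W a b where W: "zero_object C W" "a \<in> Hom C Y W" "b \<in> Hom C W Z" "g = b \<cdot> a"
    using zero_morphismE[OF assms(1,3)] .
  then show ?thesis
    using zero_morphismI[OF W(1) Comp_Hom[OF assms(2) W(2)] W(3)] Comp_assoc assms(2) by metis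
qed

lemma is_kernelD:
  assumes "is_kernel C k f"
  shows "k \<in> Hom C (Dom C k) (Dom C f)" "f \<in> Hom C (Dom C f) (Cod C f)" "zero_morphism C (f \<cdot> k)"
  using assms unfolding is_kernel_def by (simp_all add: HomI)

lemma is_cokernelD:
  assumes "is_cokernel C c f"
  shows "f \<in> Hom C (Dom C f) (Cod C f)" "c \<in> Hom C (Cod C f) (Cod C c)" "zero_morphism C (c \<cdot> f)"
  using assms unfolding is_cokernel_def by (simp_all add: HomI)

lemma is_kernel_lift:
  assumes "is_kernel C k f" "k \<in> Hom C X Y" "f \<in> Hom C Y Z" "h \<in> Hom C W Y" "zero_morphism C (f \<cdot> h)"
  shows "\<exists>!u. u \<in> Hom C W X \<and> k \<cdot> u = h"
proof -
  have "\<forall>h \<in> Mor C. Cod C h = Dom C f \<and> zero_morphism C (f \<cdot> h) \<longrightarrow>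
      (\<exists>!u. u \<in> Hom C (Dom C h) (Dom C k) \<and> k \<cdot> u = h)"
    using assms(1) unfolding is_kernel_def by (elim conjE)
  from bspec[OF this HomD(1)[OF assms(4)]] show ?thesis
    using assms(5) HomD(2,3)[OF assms(2)] HomD(2,3)[OF assms(3)] HomD(2,3)[OF assms(4)] by simp
qed

lemma is_cokernel_colift:
  assumes "is_cokernel C c f" "f \<in> Hom C X Y" "c \<in> Hom C Y Z" "h \<in> Hom C Y W" "zero_morphism C (h \<cdot> f)"
  shows "\<exists>!u. u \<in> Hom C Z W \<and> u \<cdot> c = h"
proof -
  have "\<forall>h \<in> Mor C. Dom C h = Cod C f \<and> zero_morphism C (h \<cdot> f) \<longrightarrow>
      (\<exists>!u. u \<in> Hom C (Cod C c) (Cod C h) \<and> u \<cdot> c = h)"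
    using assms(1) unfolding is_cokernel_def by (elim conjE)
  from bspec[OF this HomD(1)[OF assms(4)]] show ?thesis
    using assms(5) HomD(2,3)[OF assms(2)] HomD(2,3)[OF assms(3)] HomD(2,3)[OF assms(4)] by simp
qed

lemma is_kernelI:
  assumes "k \<in> Hom C X Y" "f \<in> Hom C Y Z" "zero_morphism C (f \<cdot> k)"
    and "\<And>W h. h \<in> Hom C W Y \<Longrightarrow> zero_morphism C (f \<cdot> h) \<Longrightarrow> \<exists>!u. u \<in> Hom C W X \<and> k \<cdot> u = h"
  shows "is_kernel C k f"
  unfolding is_kernel_def
proof (intro conjI ballI impI)
  fix h assume "h \<in> Mor C" "Cod C h = Dom C f \<and> zero_morphism C (f \<cdot> h)"
  then show "\<exists>!u. u \<in> Hom C (Dom C h) (Dom C k) \<and> k \<cdot> u = h"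
    using assms(4)[of h "Dom C h"] HomD[OF assms(1)] HomD[OF assms(2)] by (simp add: HomI)
qed (use HomD[OF assms(1)] HomD[OF assms(2)] assms(3) in simp_all)

end

section \<open>Short exact sequences\<close>

text \<open>The objects are made explicit because every computation below needs the types of the
  arrows.\<close>

definition ses ::
  "('o, 'm, 'z) deflation_category_scheme \<Rightarrow> 'o \<Rightarrow> 'o \<Rightarrow> 'o \<Rightarrow> 'm \<Rightarrow> 'm \<Rightarrow> bool"
  where "ses C X Y Z i p \<longleftrightarrow> i \<in> Hom C X Y \<and> p \<in> Hom C Y Z \<and> short_exact C i p"

context weakly_exact_category
begin

lemma sesD:
  assumes "ses C X Y Z i p"
  shows "i \<in> Hom C X Y" "p \<in> Hom C Y Z" "short_exact C i p" "p \<in> Defl C" "zero_morphism C (p \<cdot> i)"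
  using assms is_kernelD(3) by (simp_all add: ses_def short_exact_def)

lemma ses_of_short_exact:
  assumes "short_exact C i p"
  shows "ses C (Dom C i) (Dom C p) (Cod C p) i p"
  using assms is_kernelD[of i p] by (simp add: ses_def short_exact_def)

lemma ses_is_kernel: "ses C X Y Z i p \<Longrightarrow> is_kernel C i p"
  by (simp add: ses_def short_exact_def)

lemma ses_lift:
  assumes "ses C X Y Z i p" "h \<in> Hom C W Y" "zero_morphism C (p \<cdot> h)"
  obtains u where "u \<in> Hom C W X" "i \<cdot> u = h"
  using is_kernel_lift[OF ses_is_kernel sesD(1,2)] assms by blast

text \<open>Uniqueness of the factorization of \<open>i \<cdot> u\<close> through the kernel \<open>i\<close>.\<close>

lemma ses_mono:
  assumes "ses C X Y Z i p" "u \<in> Hom C W X" "v \<in> Hom C W X" "i \<cdot> u = i \<cdot> v"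
  shows "u = v"
proof -
  note s = sesD[OF assms(1)]
  have h: "i \<cdot> u \<in> Hom C W Y" using Comp_Hom[OF assms(2) s(1)] .
  have "zero_morphism C (p \<cdot> (i \<cdot> u))"
    using zero_comp_left[OF s(5) assms(2) Comp_Hom[OF s(1,2)]] Comp_assoc[OF assms(2) s(1,2)] by simp
  then have "\<exists>!w. w \<in> Hom C W X \<and> i \<cdot> w = i \<cdot> u"
    using is_kernel_lift[OF ses_is_kernel[OF assms(1)] s(1,2) h] by simp
  then show ?thesis using assms by metis
qed

lemma ses_is_cokernel: "ses C X Y Z i p \<Longrightarrow> is_cokernel C p i"
  unfolding ses_def short_exact_def by (auto intro: Defl_is_cokernel)

lemma ses_colift:
  assumes "ses C X Y Z i p" "h \<in> Hom C Y W" "zero_morphism C (h \<cdot> i)"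
  obtains u where "u \<in> Hom C Z W" "u \<cdot> p = h"
  using is_cokernel_colift[OF ses_is_cokernel sesD(1,2)] assms by blast

text \<open>Dually, the deflation is a cokernel, so factorizations of \<open>u \<cdot> p\<close> through it are unique.\<close>

lemma ses_epi:
  assumes "ses C X Y Z i p" "u \<in> Hom C Z W" "v \<in> Hom C Z W" "u \<cdot> p = v \<cdot> p"
  shows "u = v"
proof -
  note s = sesD[OF assms(1)]
  have h: "u \<cdot> p \<in> Hom C Y W" using Comp_Hom[OF s(2) assms(2)] .
  have "zero_morphism C ((u \<cdot> p) \<cdot> i)"
    using zero_comp_right[OF s(5) Comp_Hom[OF s(1,2)] assms(2)] Comp_assoc[OF s(1,2) assms(2)] by simp
  then have "\<exists>!w. w \<in> Hom C Z W \<and> w \<cdot> p = u \<cdot> p"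
    using is_cokernel_colift[OF ses_is_cokernel[OF assms(1)] s(1,2) h] by simp
  then show ?thesis using assms by metis
qed

lemma ses_zero_cancel:
  assumes "ses C X Y Z i p" "u \<in> Hom C W X" "zero_morphism C (i \<cdot> u)"
  shows "zero_morphism C u"
proof -
  note i = sesD(1)[OF assms(1)]
  obtain O' where O': "zero_object C O'" using zero_object_exists by blast
  obtain a b where ab: "a \<in> Hom C W O'" "b \<in> Hom C O' X"
    using zero_object_unique[OF O'] HomD[OF assms(2)] by metis
  have z: "zero_morphism C (b \<cdot> a)" "b \<cdot> a \<in> Hom C W X"
    using zero_morphismI[OF O' ab] Comp_Hom[OF ab] by auto
  have "i \<cdot> u = i \<cdot> (b \<cdot> a)"
    using zero_morphism_unique[OF assms(3) zero_comp_right[OF z i]]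
      Comp_Hom[OF assms(2) i] Comp_Hom[OF z(2) i] by blast
  then show ?thesis using ses_mono[OF assms(1,2) z(2)] z(1) by simp
qed

lemma deflation_ses:
  assumes "p \<in> Defl C" "p \<in> Hom C Y Z"
  obtains X i where "ses C X Y Z i p"
proof -
  obtain i where "is_kernel C i p" using Defl_has_kernel assms by blast
  then have "ses C (Dom C i) Y Z i p"
    using assms ses_of_short_exact[of i p] HomD[OF assms(2)] by (simp add: short_exact_def)
  then show ?thesis using that by blast
qed

lemma is_iso_Id: "X \<in> Obj C \<Longrightarrow> is_iso C (Id C X)"
  using Id_Hom[of X] Comp_Id_left[OF Id_Hom, of X] HomD[OF Id_Hom, of X]
  unfolding is_iso_def by auto

lemma ses_zero_Id:
  assumes "zero_object C O'" "z \<in> Hom C O' X"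
  shows "ses C O' X X z (Id C X)"
proof -
  have X: "X \<in> Obj C" "O' \<in> Obj C" using HomD assms by auto
  note I = Id_Hom[OF X(1)]
  have "is_kernel C z (Id C X)"
  proof (rule is_kernelI[OF assms(2) I])
    show "zero_morphism C (Id C X \<cdot> z)"
      using zero_morphismI[OF assms(1) Id_Hom[OF X(2)] assms(2)] Comp_Id_right[OF assms(2)]
        Comp_Id_left[OF assms(2)] by simp
  next
    fix W h assume hH: "h \<in> Hom C W X" and h: "zero_morphism C (Id C X \<cdot> h)"
    then have hz: "zero_morphism C h" using Comp_Id_left by simp
    obtain t where t: "t \<in> Hom C W O'"
      using zero_object_unique(1)[OF assms(1)] HomD[OF hH] by metis
    have "z \<cdot> t = h"
      using zero_morphism_unique[OF zero_morphismI[OF assms(1) t assms(2)] hz]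
        Comp_Hom[OF t assms(2)] hH by blast
    then show "\<exists>!u. u \<in> Hom C W O' \<and> z \<cdot> u = h"
      using t to_zero_object_eq[OF assms(1)] by metis
  qed
  then show ?thesis
    using I assms iso_Defl is_iso_Id X by (simp add: ses_def short_exact_def)
qed

lemma ses_Id_zero:
  assumes "zero_object C O'" "z \<in> Hom C X O'"
  shows "ses C X X O' (Id C X) z"
proof -
  have X: "X \<in> Obj C" "O' \<in> Obj C" using HomD assms by auto
  note I = Id_Hom[OF X(1)]
  have "is_kernel C (Id C X) z"
  proof (rule is_kernelI[OF I assms(2)])
    show "zero_morphism C (z \<cdot> Id C X)"
      using zero_morphismI[OF assms Id_Hom[OF X(2)]] Comp_Id_right[OF assms(2)]
        Comp_Id_left[OF assms(2)] by simp
  next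
    fix W h assume "h \<in> Hom C W X"
    then show "\<exists>!u. u \<in> Hom C W X \<and> Id C X \<cdot> u = h"
      using Comp_Id_left by metis
  qed
  then show ?thesis
    using I assms to_zero_Defl by (simp add: ses_def short_exact_def)
qed

text \<open>The axiom on cancelling a deflation on the right, in the form in which it shows that induced
  morphisms are deflations.\<close>

lemma deflation_factor:
  assumes "ses C X Y Z i p" "g \<in> Hom C Z W" "g \<cdot> p \<in> Defl C"
  shows "g \<in> Defl C"
  using Defl_cancel[of p g] assms sesD[OF assms(1)] HomD[OF sesD(2)[OF assms(1)]] HomD[OF assms(2)]
  by simp

text \<open>An inflation has a deflation \<open>p\<close> as one of its cokernels. Any other cokernel differs from
  \<open>p\<close> by an isomorphism, hence is a deflation with the same kernel.\<close>

lemma cokernel_of_inflation_ses: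
  assumes "inflation C i" "is_cokernel C c i" "i \<in> Hom C X Y" "c \<in> Hom C Y Z"
  shows "ses C X Y Z i c"
proof -
  obtain p where p: "p \<in> Defl C" "is_kernel C i p" using assms(1) by (auto simp: inflation_def)
  define P where "P = Cod C p"
  have "Dom C i = X" "Dom C p = Y"
    using HomD(2,3)[OF assms(3)] HomD(3)[OF is_kernelD(1)[OF p(2)]] by simp_all
  then have s: "ses C X Y P i p"
    using ses_of_short_exact[of i p] p by (simp add: short_exact_def P_def)
  note sp = sesD[OF s]
  have cz: "zero_morphism C (c \<cdot> i)" using assms(2) by (rule is_cokernelD)
  have colift: "\<exists>!u. u \<in> Hom C Z W \<and> u \<cdot> c = h"
    if "h \<in> Hom C Y W" "zero_morphism C (h \<cdot> i)" for h W
    using is_cokernel_colift[OF assms(2-4) that] .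
  obtain v where v: "v \<in> Hom C P Z" "v \<cdot> p = c" using ses_colift[OF s assms(4) cz] .
  obtain u where u: "u \<in> Hom C Z P" "u \<cdot> c = p" using colift[OF sp(2,5)] by blast
  have uv: "u \<cdot> v = Id C P"
    using ses_epi[OF s Comp_Hom[OF v(1) u(1)] Id_Hom[OF HomD(5)[OF sp(2)]]]
      Comp_assoc[OF sp(2) v(1) u(1)] u v Comp_Id_left[OF sp(2)] by simp
  have vu: "v \<cdot> u = Id C Z"
  proof -
    have "(v \<cdot> u) \<cdot> c = c" using Comp_assoc[OF assms(4) u(1) v(1)] u v by simp
    then show ?thesis
      using colift[OF assms(4) cz] Comp_Hom[OF u(1) v(1)] Id_Hom[OF HomD(5)[OF assms(4)]]
        Comp_Id_left[OF assms(4)] by blast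
  qed
  have "is_iso C v"
    unfolding is_iso_def using HomD[OF v(1)] u(1) uv vu by auto
  then have c: "c \<in> Defl C"
    using Defl_Comp[OF sp(4) iso_Defl] v HomD[OF sp(2)] HomD[OF v(1)] by auto
  have "is_kernel C i c"
  proof (rule is_kernelI[OF assms(3,4) cz])
    fix W h assume hH: "h \<in> Hom C W Y" and h: "zero_morphism C (c \<cdot> h)"
    have "zero_morphism C (p \<cdot> h)"
      using zero_comp_right[OF _ Comp_Hom[OF hH assms(4)] u(1)] h
        Comp_assoc[OF hH assms(4) u(1)] u(2) by simp
    then show "\<exists>!u. u \<in> Hom C W X \<and> i \<cdot> u = h"
      using is_kernel_lift[OF p(2) sp(1,2) hH] by simp
  qed
  then show ?thesis using assms c by (simp add: ses_def short_exact_def)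
qed

section \<open>Consequences of the three-by-three axiom\<close>

lemma comm_squareI:
  assumes "t \<in> Hom C X Y" "l \<in> Hom C X V" "r \<in> Hom C Y W" "b \<in> Hom C V W" "r \<cdot> t = b \<cdot> l"
  shows "comm_square C t l r b"
  using assms by (auto simp: comm_square_def Hom_def)

text \<open>The three-by-three axiom for the diagram with rows \<open>K \<rightarrow> L \<rightarrow> M\<close>, \<open>K \<rightarrow> X \<rightarrow> Y\<close> and
  \<open>0 \<rightarrow> Z = Z\<close>, whose columns are \<open>K = K \<rightarrow> 0\<close>, \<open>L \<rightarrow> X \<rightarrow> Z\<close> and \<open>M \<rightarrow> Y \<rightarrow> Z\<close>.\<close>

lemma kernels_of_composite_ses:
  assumes k: "ses C K X Y k p" and l: "ses C L X Z l (q \<cdot> p)" and m: "ses C M Y Z m q"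
  obtains u v where "ses C K L M u v" "l \<cdot> u = k" "m \<cdot> v = p \<cdot> l"
proof -
  note K = sesD[OF k] and L = sesD[OF l] and M = sesD[OF m]
  have qpk: "zero_morphism C ((q \<cdot> p) \<cdot> k)"
    using zero_comp_right[OF K(5) Comp_Hom[OF K(1,2)] M(2)] Comp_assoc[OF K(1,2) M(2)] by simp
  obtain u where u: "u \<in> Hom C K L" "l \<cdot> u = k" using ses_lift[OF l K(1) qpk] .
  have "zero_morphism C (q \<cdot> (p \<cdot> l))" using L(5) Comp_assoc[OF L(1) K(2) M(2)] by simp
  then obtain v where v: "v \<in> Hom C L M" "m \<cdot> v = p \<cdot> l"
    using ses_lift[OF m Comp_Hom[OF L(1) K(2)]] by metis
  obtain O' where O': "zero_object C O'" using zero_object_exists by blast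
  have ob: "K \<in> Obj C" "Z \<in> Obj C" using HomD[OF K(1)] HomD[OF M(2)] by auto
  obtain a b where ab: "a \<in> Hom C K O'" "b \<in> Hom C O' Z"
    using zero_object_unique[OF O'] ob by metis
  have "short_exact C u v"
  proof (rule three_by_three)
    show "comm_square C u (Id C K) l k"
      using comm_squareI[OF u(1) Id_Hom[OF ob(1)] L(1) K(1)] u(2) Comp_Id_right[OF K(1)] by simp
    show "comm_square C v l m p" using comm_squareI[OF v(1) L(1) M(1) K(2)] v(2) by simp
    have "(q \<cdot> p) \<cdot> k = b \<cdot> a"
      using zero_morphism_unique[OF qpk zero_morphismI[OF O' ab]] Comp_Hom[OF K(1) L(2)] Comp_Hom[OF ab]
      by blast
    then show "comm_square C k a (q \<cdot> p) b" using comm_squareI[OF K(1) ab(1) L(2) ab(2)] by simp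
    show "comm_square C p (q \<cdot> p) q (Id C Z)"
      using comm_squareI[OF K(2) L(2) M(2) Id_Hom[OF ob(2)]] Comp_Id_left[OF L(2)] by simp
    show "short_exact C (Id C K) a" using sesD(3)[OF ses_Id_zero[OF O' ab(1)]] .
    show "short_exact C b (Id C Z)" using sesD(3)[OF ses_zero_Id[OF O' ab(2)]] .
  qed (use K L M in auto)
  then show ?thesis using that u v by (simp add: ses_def)
qed

text \<open>The three-by-three axiom for the diagram with rows \<open>K \<rightarrow> B \<rightarrow> X\<close>, \<open>A \<rightarrow> P \<rightarrow> X\<close> and
  \<open>Y = Y \<rightarrow> 0\<close>, whose columns are \<open>K \<rightarrow> A \<rightarrow> Y\<close>, \<open>B \<rightarrow> P \<rightarrow> Y\<close> and \<open>X = X \<rightarrow> 0\<close>.\<close>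

lemma diamond_ses:
  assumes u: "ses C A P X u p" and v: "ses C B P Y v q" and k: "ses C K A Y k (q \<cdot> u)"
    and k': "k' \<in> Hom C K B" "v \<cdot> k' = u \<cdot> k"
  shows "ses C K B X k' (p \<cdot> v)"
proof -
  note U = sesD[OF u] and V = sesD[OF v] and K = sesD[OF k]
  obtain O' where O': "zero_object C O'" using zero_object_exists by blast
  have ob: "P \<in> Obj C" "X \<in> Obj C" "Y \<in> Obj C" using HomD[OF U(2)] HomD[OF V(2)] by auto
  obtain a b where ab: "a \<in> Hom C X O'" "b \<in> Hom C Y O'"
    using zero_object_unique[OF O'] ob by metis
  have pv: "p \<cdot> v \<in> Hom C B X" using Comp_Hom[OF V(1) U(2)] .
  have "short_exact C k' (p \<cdot> v)"
  proof (rule three_by_three)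
    show "comm_square C k' k v u" using comm_squareI[OF k'(1) K(1) V(1) U(1) k'(2)] .
    show "comm_square C (p \<cdot> v) v (Id C X) p"
      using comm_squareI[OF pv V(1) Id_Hom[OF ob(2)] U(2)] Comp_Id_left[OF pv] by simp
    show "comm_square C u (q \<cdot> u) q (Id C Y)"
      using comm_squareI[OF U(1) K(2) V(2) Id_Hom[OF ob(3)]] Comp_Id_left[OF K(2)] by simp
    have "a \<cdot> p = b \<cdot> q"
      using to_zero_object_eq[OF O' Comp_Hom[OF U(2) ab(1)] Comp_Hom[OF V(2) ab(2)]] .
    then show "comm_square C p q a b" using comm_squareI[OF U(2) V(2) ab] by simp
    show "short_exact C (Id C X) a" using sesD(3)[OF ses_Id_zero[OF O' ab(1)]] .
    show "short_exact C (Id C Y) b" using sesD(3)[OF ses_Id_zero[OF O' ab(2)]] .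
  qed (use U V K in auto)
  then show ?thesis using k' pv by (simp add: ses_def)
qed

section \<open>Induced morphisms\<close>

text \<open>A commutative square between admissible morphisms extends to their kernels, images and
  cokernels, whatever the factorizations are. Everything rests on \<open>e' \<cdot> a \<cdot> k\<close> being zero, which
  may be tested after composing with the monomorphism \<open>m'\<close>.\<close>

lemma induced_morphisms:
  assumes k: "ses C K A I k e" and m: "ses C I B Q m c"
    and k': "ses C K' A' I' k' e'" and m': "ses C I' B' Q' m' c'"
    and a: "a \<in> Hom C A A'" and b: "b \<in> Hom C B B'"
    and sq: "b \<cdot> (m \<cdot> e) = (m' \<cdot> e') \<cdot> a"
  obtains \<kappa> r \<gamma> where "\<kappa> \<in> Hom C K K'" "k' \<cdot> \<kappa> = a \<cdot> k"
    "r \<in> Hom C I I'" "r \<cdot> e = e' \<cdot> a" "m' \<cdot> r = b \<cdot> m"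
    "\<gamma> \<in> Hom C Q Q'" "\<gamma> \<cdot> c = c' \<cdot> b"
proof -
  note h = sesD(1,2)[OF k] sesD(1,2)[OF m] sesD(1,2)[OF k'] sesD(1,2)[OF m'] a b
  have e'a: "e' \<cdot> a \<in> Hom C A I'" using h Comp_Hom by blast
  have "m' \<cdot> ((e' \<cdot> a) \<cdot> k) = (b \<cdot> m) \<cdot> (e \<cdot> k)"
    using comp_extend[OF sq Comp_Hom[OF h(2,3)] b, of k] h by (simp add: comp_simps)
  moreover have "zero_morphism C ((b \<cdot> m) \<cdot> (e \<cdot> k))"
    using zero_comp_right[OF sesD(5)[OF k]] h Comp_Hom by blast
  ultimately have z: "zero_morphism C ((e' \<cdot> a) \<cdot> k)"
    using ses_zero_cancel[OF m' Comp_Hom[OF h(1) e'a]] by simp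
  obtain r where r: "r \<in> Hom C I I'" "r \<cdot> e = e' \<cdot> a" using ses_colift[OF k e'a z] .
  have "zero_morphism C (e' \<cdot> (a \<cdot> k))" using z Comp_assoc[OF h(1) a h(6)] by simp
  then obtain \<kappa> where \<kappa>: "\<kappa> \<in> Hom C K K'" "k' \<cdot> \<kappa> = a \<cdot> k"
    using ses_lift[OF k' Comp_Hom[OF h(1) a]] by metis
  have mr: "m' \<cdot> r = b \<cdot> m"
    using ses_epi[OF k Comp_Hom[OF r(1) h(7)] Comp_Hom[OF h(3) b]] r sq h by (simp add: comp_simps)
  have "(c' \<cdot> b) \<cdot> m = (c' \<cdot> m') \<cdot> r" using mr h r by (simp add: comp_simps)
  then have "zero_morphism C ((c' \<cdot> b) \<cdot> m)"
    using zero_comp_left[OF sesD(5)[OF m'] r(1)] h Comp_Hom by metis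
  then obtain \<gamma> where "\<gamma> \<in> Hom C Q Q'" "\<gamma> \<cdot> c = c' \<cdot> b"
    using ses_colift[OF m Comp_Hom[OF b h(8)]] by metis
  then show ?thesis using that r \<kappa> mr by blast
qed

lemma ker_map_eq:
  assumes "ses C K' A' I' k' e'" "k \<in> Hom C K A" "\<kappa> \<in> Hom C K K'" "k' \<cdot> \<kappa> = a \<cdot> k"
  shows "ker_map C k k' a = \<kappa>"
  unfolding ker_map_def
  using assms ses_mono[OF assms(1)] HomD[OF assms(2)] HomD[OF sesD(1)[OF assms(1)]]
  by (intro the_equality) auto

lemma coker_map_eq:
  assumes "ses C I B Q m c" "c' \<in> Hom C B' Q'" "\<gamma> \<in> Hom C Q Q'" "\<gamma> \<cdot> c = c' \<cdot> b"
  shows "coker_map C c c' b = \<gamma>"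
  unfolding coker_map_def
  using assms ses_epi[OF assms(1)] HomD[OF assms(2)] HomD[OF sesD(2)[OF assms(1)]]
  by (intro the_equality) auto

section \<open>The two halves of the snake\<close>

text \<open>Let \<open>M\<close> be the kernel of \<open>B\<^sub>2 \<rightarrow> C\<^sub>3\<close>, in which both \<open>I\<^sub>2\<close> and \<open>B\<^sub>1\<close> are kernels of
  deflations: \<open>I\<^sub>2 \<rightarrow> M \<rightarrow> N\<close>, where \<open>N\<close> is the kernel of \<open>C\<^sub>2 \<rightarrow> C\<^sub>3\<close>, and
  \<open>B\<^sub>1 \<rightarrow> M \<rightarrow> I\<^sub>3\<close>. The composite \<open>I\<^sub>2 \<rightarrow> M \<rightarrow> I\<^sub>3\<close> is the deflation \<open>r\<^sub>2\<close> with kernel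
  \<open>J\<close>, so the diamond gives a short exact sequence \<open>J \<rightarrow> B\<^sub>1 \<rightarrow> N\<close>. As \<open>B\<^sub>1 \<rightarrow> N\<close> factors
  through the deflation \<open>c\<^sub>1\<close>, comparing kernels yields \<open>I\<^sub>1 \<rightarrow> J \<rightarrow> Q\<close> with \<open>Q\<close> the kernel of
  \<open>C\<^sub>1 \<rightarrow> N\<close>.\<close>

lemma cokernel_side:
  assumes \<beta>: "ses C B\<^sub>1 B\<^sub>2 B\<^sub>3 \<beta>\<^sub>1 \<beta>\<^sub>2"
    and c1: "ses C I\<^sub>1 B\<^sub>1 C\<^sub>1 m\<^sub>1 c\<^sub>1" and c2: "ses C I\<^sub>2 B\<^sub>2 C\<^sub>2 m\<^sub>2 c\<^sub>2" and c3: "ses C I\<^sub>3 B\<^sub>3 C\<^sub>3 m\<^sub>3 c\<^sub>3"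
    and r1: "r\<^sub>1 \<in> Hom C I\<^sub>1 I\<^sub>2" "m\<^sub>2 \<cdot> r\<^sub>1 = \<beta>\<^sub>1 \<cdot> m\<^sub>1"
    and r2: "ses C J I\<^sub>2 I\<^sub>3 j r\<^sub>2" "m\<^sub>3 \<cdot> r\<^sub>2 = \<beta>\<^sub>2 \<cdot> m\<^sub>2"
    and \<gamma>1: "\<gamma>\<^sub>1 \<in> Hom C C\<^sub>1 C\<^sub>2" "\<gamma>\<^sub>1 \<cdot> c\<^sub>1 = c\<^sub>2 \<cdot> \<beta>\<^sub>1"
    and \<gamma>2: "\<gamma>\<^sub>2 \<in> Hom C C\<^sub>2 C\<^sub>3" "\<gamma>\<^sub>2 \<cdot> c\<^sub>2 = c\<^sub>3 \<cdot> \<beta>\<^sub>2"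
  obtains Q N d o' p z i n where
    "d \<in> Hom C J B\<^sub>1" "\<beta>\<^sub>1 \<cdot> d = m\<^sub>2 \<cdot> j"
    "ses C I\<^sub>1 J Q o' p" "j \<cdot> o' = r\<^sub>1"
    "ses C Q C\<^sub>1 N z i" "z \<cdot> p = c\<^sub>1 \<cdot> d"
    "ses C N C\<^sub>2 C\<^sub>3 n \<gamma>\<^sub>2" "n \<cdot> i = \<gamma>\<^sub>1"
proof -
  note h = sesD(1,2)[OF \<beta>] sesD(1,2)[OF c1] sesD(1,2)[OF c2] sesD(1,2)[OF c3]
    r1(1) sesD(1,2)[OF r2(1)] \<gamma>1(1) \<gamma>2(1)
  have c3\<beta>2: "c\<^sub>3 \<cdot> \<beta>\<^sub>2 \<in> Hom C B\<^sub>2 C\<^sub>3" "c\<^sub>3 \<cdot> \<beta>\<^sub>2 \<in> Defl C"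
    using Comp_Hom[OF h(2,8)] Defl_Comp[OF sesD(4)[OF \<beta>] sesD(4)[OF c3]] HomD[OF h(2)] HomD[OF h(8)]
    by auto
  have "\<gamma>\<^sub>2 \<in> Defl C" using deflation_factor[OF c2 \<gamma>2(1)] \<gamma>2(2) c3\<beta>2(2) by simp
  then obtain N n where n: "ses C N C\<^sub>2 C\<^sub>3 n \<gamma>\<^sub>2" using deflation_ses[OF _ \<gamma>2(1)] by blast
  obtain M t where t: "ses C M B\<^sub>2 C\<^sub>3 t (c\<^sub>3 \<cdot> \<beta>\<^sub>2)" using deflation_ses[OF c3\<beta>2(2,1)] .
  obtain g g' where g: "ses C I\<^sub>2 M N g g'" "t \<cdot> g = m\<^sub>2" "n \<cdot> g' = c\<^sub>2 \<cdot> t"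
    using kernels_of_composite_ses[OF c2 _ n] t \<gamma>2(2) by metis
  obtain b s where b: "ses C B\<^sub>1 M I\<^sub>3 b s" "t \<cdot> b = \<beta>\<^sub>1" "m\<^sub>3 \<cdot> s = \<beta>\<^sub>2 \<cdot> t"
    using kernels_of_composite_ses[OF \<beta> t c3] .
  note h = h sesD(1,2)[OF n] sesD(1)[OF t] sesD(1,2)[OF g(1)] sesD(1,2)[OF b(1)]
  \<comment> \<open>This composite is what makes the diamond applicable to \<open>I\<^sub>2\<close> and \<open>B\<^sub>1\<close> in \<open>M\<close>.\<close>
  have sg: "s \<cdot> g = r\<^sub>2"
  proof (rule ses_mono[OF c3])
    show "m\<^sub>3 \<cdot> (s \<cdot> g) = m\<^sub>3 \<cdot> r\<^sub>2"
      using comp_extend[OF b(3), where x = g] g(2) r2(2) h by (simp add: comp_simps)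
  qed (use h in \<open>auto intro: Comp_Hom\<close>)
  have "zero_morphism C (s \<cdot> (g \<cdot> j))"
    using sesD(5)[OF r2(1)] sg h by (auto simp: comp_simps)
  then obtain d where d: "d \<in> Hom C J B\<^sub>1" "b \<cdot> d = g \<cdot> j"
    using ses_lift[OF b(1)] Comp_Hom[OF h(10) sesD(1)[OF g(1)]] by metis
  have dh: "ses C J B\<^sub>1 N d (g' \<cdot> b)"
    using diamond_ses[OF g(1) b(1) _ d] r2(1) sg by simp
  note h = h d(1) sesD(2)[OF dh]
  have \<beta>d: "\<beta>\<^sub>1 \<cdot> d = m\<^sub>2 \<cdot> j"
    using comp_extend[OF b(2), where x = d] comp_extend[OF g(2), where x = j] d(2) h
    by (simp add: comp_simps)
  have ng'b: "n \<cdot> (g' \<cdot> b) = c\<^sub>2 \<cdot> \<beta>\<^sub>1"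
    using comp_extend[OF g(3), where x = b] b(2) h by (simp add: comp_simps)
  \<comment> \<open>\<open>B\<^sub>1 \<rightarrow> N\<close> kills \<open>I\<^sub>1\<close>: inside \<open>C\<^sub>2\<close> it becomes \<open>c\<^sub>2 \<cdot> \<beta>\<^sub>1\<close>, and \<open>I\<^sub>1\<close> maps into \<open>I\<^sub>2\<close>.\<close>
  have "zero_morphism C ((g' \<cdot> b) \<cdot> m\<^sub>1)"
  proof (rule ses_zero_cancel[OF n])
    show "zero_morphism C (n \<cdot> ((g' \<cdot> b) \<cdot> m\<^sub>1))"
    proof -
      have "n \<cdot> ((g' \<cdot> b) \<cdot> m\<^sub>1) = (c\<^sub>2 \<cdot> m\<^sub>2) \<cdot> r\<^sub>1"
        using comp_extend[OF ng'b, where x = "m\<^sub>1"] r1(2) h by (simp add: comp_simps)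
      then show ?thesis
        using zero_comp_left[OF sesD(5)[OF c2] r1(1) Comp_Hom[OF h(5,6)]] by simp
    qed
  qed (use h in \<open>auto intro: Comp_Hom\<close>)
  then obtain i where i: "i \<in> Hom C C\<^sub>1 N" "i \<cdot> c\<^sub>1 = g' \<cdot> b"
    using ses_colift[OF c1 sesD(2)[OF dh]] by metis
  have "i \<in> Defl C" using deflation_factor[OF c1 i(1)] i(2) sesD(4)[OF dh] by simp
  then obtain Q z where z: "ses C Q C\<^sub>1 N z i" using deflation_ses[OF _ i(1)] by blast
  obtain o' p where o: "ses C I\<^sub>1 J Q o' p" "d \<cdot> o' = m\<^sub>1" "z \<cdot> p = c\<^sub>1 \<cdot> d"
    using kernels_of_composite_ses[OF c1 _ z] dh i(2) by metis
  note h = h i(1) sesD(1,2)[OF z] sesD(1,2)[OF o(1)]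
  have "n \<cdot> i = \<gamma>\<^sub>1"
  proof (rule ses_epi[OF c1])
    show "(n \<cdot> i) \<cdot> c\<^sub>1 = \<gamma>\<^sub>1 \<cdot> c\<^sub>1"
      using i(2) ng'b \<gamma>1(2) h by (simp add: comp_simps)
  qed (use h in \<open>auto intro: Comp_Hom\<close>)
  moreover have "j \<cdot> o' = r\<^sub>1"
  proof (rule ses_mono[OF c2])
    show "m\<^sub>2 \<cdot> (j \<cdot> o') = m\<^sub>2 \<cdot> r\<^sub>1"
      using comp_extend[OF \<beta>d, where x = o'] o(2) r1(2) h by (simp add: comp_simps)
  qed (use h in \<open>auto intro: Comp_Hom\<close>)
  ultimately show ?thesis using that d(1) \<beta>d o(1) z o(3) n by blast
qed

text \<open>The kernel \<open>L\<close> of \<open>A\<^sub>2 \<rightarrow> I\<^sub>3\<close> is computed along both sides of the square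
  \<open>r\<^sub>2 \<cdot> e\<^sub>2 = e\<^sub>3 \<cdot> \<phi>\<^sub>2\<close>, giving \<open>K\<^sub>2 \<rightarrow> L \<rightarrow> J\<close> and \<open>A\<^sub>1 \<rightarrow> L \<rightarrow> K\<^sub>3\<close>. The deflation
  \<open>L \<rightarrow> J \<rightarrow> Q\<close> vanishes on \<open>A\<^sub>1\<close>, so it also factors as \<open>L \<rightarrow> K\<^sub>3 \<rightarrow> Q\<close>. Let \<open>T\<close> be its
  kernel and \<open>R\<close> that of \<open>K\<^sub>3 \<rightarrow> Q\<close>; the two factorizations give \<open>K\<^sub>2 \<rightarrow> T \<rightarrow> I\<^sub>1\<close> and
  \<open>A\<^sub>1 \<rightarrow> T \<rightarrow> R\<close>. Since \<open>A\<^sub>1 \<rightarrow> T \<rightarrow> I\<^sub>1\<close> is the deflation \<open>e\<^sub>1\<close> with kernel \<open>K\<^sub>1\<close>,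
  the diamond gives \<open>K\<^sub>1 \<rightarrow> K\<^sub>2 \<rightarrow> R\<close>.\<close>

lemma kernel_side:
  assumes \<phi>: "ses C A\<^sub>1 A\<^sub>2 A\<^sub>3 \<phi>\<^sub>1 \<phi>\<^sub>2"
    and e1: "ses C K\<^sub>1 A\<^sub>1 I\<^sub>1 k\<^sub>1 e\<^sub>1" and e2: "ses C K\<^sub>2 A\<^sub>2 I\<^sub>2 k\<^sub>2 e\<^sub>2" and e3: "ses C K\<^sub>3 A\<^sub>3 I\<^sub>3 k\<^sub>3 e\<^sub>3"
    and r1: "r\<^sub>1 \<cdot> e\<^sub>1 = e\<^sub>2 \<cdot> \<phi>\<^sub>1"
    and r2: "ses C J I\<^sub>2 I\<^sub>3 j r\<^sub>2" "r\<^sub>2 \<cdot> e\<^sub>2 = e\<^sub>3 \<cdot> \<phi>\<^sub>2"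
    and o: "ses C I\<^sub>1 J Q o' p" "j \<cdot> o' = r\<^sub>1"
    and \<kappa>1: "\<kappa>\<^sub>1 \<in> Hom C K\<^sub>1 K\<^sub>2" "k\<^sub>2 \<cdot> \<kappa>\<^sub>1 = \<phi>\<^sub>1 \<cdot> k\<^sub>1"
    and \<kappa>2: "\<kappa>\<^sub>2 \<in> Hom C K\<^sub>2 K\<^sub>3" "k\<^sub>3 \<cdot> \<kappa>\<^sub>2 = \<phi>\<^sub>2 \<cdot> k\<^sub>2"
  obtains L R l q y s \<rho> \<pi> where
    "ses C L A\<^sub>2 I\<^sub>3 l (e\<^sub>3 \<cdot> \<phi>\<^sub>2)"
    "q \<in> Defl C" "q \<in> Hom C L K\<^sub>3" "k\<^sub>3 \<cdot> q = \<phi>\<^sub>2 \<cdot> l"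
    "y \<in> Hom C L J" "j \<cdot> y = e\<^sub>2 \<cdot> l"
    "ses C K\<^sub>1 K\<^sub>2 R \<kappa>\<^sub>1 s" "ses C R K\<^sub>3 Q \<rho> \<pi>" "\<rho> \<cdot> s = \<kappa>\<^sub>2" "\<pi> \<cdot> q = p \<cdot> y"
proof -
  note h = sesD(1,2)[OF \<phi>] sesD(1,2)[OF e1] sesD(1,2)[OF e2] sesD(1,2)[OF e3]
    sesD(1,2)[OF r2(1)] sesD(1,2)[OF o(1)] \<kappa>1(1) \<kappa>2(1)
  have e3\<phi>2: "e\<^sub>3 \<cdot> \<phi>\<^sub>2 \<in> Hom C A\<^sub>2 I\<^sub>3" "e\<^sub>3 \<cdot> \<phi>\<^sub>2 \<in> Defl C"
    using Comp_Hom[OF h(2,8)] Defl_Comp[OF sesD(4)[OF \<phi>] sesD(4)[OF e3]] HomD[OF h(2)] HomD[OF h(8)]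
    by auto
  obtain L l where l: "ses C L A\<^sub>2 I\<^sub>3 l (e\<^sub>3 \<cdot> \<phi>\<^sub>2)" using deflation_ses[OF e3\<phi>2(2,1)] .
  obtain x y where x: "ses C K\<^sub>2 L J x y" "l \<cdot> x = k\<^sub>2" "j \<cdot> y = e\<^sub>2 \<cdot> l"
    using kernels_of_composite_ses[OF e2 _ r2(1)] l r2(2) by metis
  obtain a q where a: "ses C A\<^sub>1 L K\<^sub>3 a q" "l \<cdot> a = \<phi>\<^sub>1" "k\<^sub>3 \<cdot> q = \<phi>\<^sub>2 \<cdot> l"
    using kernels_of_composite_ses[OF \<phi> l e3] .
  note h = h sesD(1)[OF l] sesD(1,2)[OF x(1)] sesD(1,2)[OF a(1)]
  have ya: "y \<cdot> a = o' \<cdot> e\<^sub>1"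
  proof (rule ses_mono[OF r2(1)])
    show "j \<cdot> (y \<cdot> a) = j \<cdot> (o' \<cdot> e\<^sub>1)"
      using comp_extend[OF x(3), where x = a] comp_extend[OF o(2), where x = "e\<^sub>1"] a(2) r1 h
      by (simp add: comp_simps)
  qed (use h in \<open>auto intro: Comp_Hom\<close>)
  have py: "p \<cdot> y \<in> Hom C L Q" "p \<cdot> y \<in> Defl C"
    using Comp_Hom[OF sesD(2)[OF x(1)] sesD(2)[OF o(1)]] HomD[OF sesD(2)[OF x(1)]]
      HomD[OF sesD(2)[OF o(1)]] Defl_Comp[OF sesD(4)[OF x(1)] sesD(4)[OF o(1)]] by auto
  \<comment> \<open>On \<open>A\<^sub>1\<close> the arrow \<open>y\<close> passes through \<open>I\<^sub>1\<close>, which \<open>p\<close> kills.\<close>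
  have "(p \<cdot> y) \<cdot> a = (p \<cdot> o') \<cdot> e\<^sub>1" using ya h by (simp add: comp_simps)
  then have "zero_morphism C ((p \<cdot> y) \<cdot> a)"
    using zero_comp_left[OF sesD(5)[OF o(1)] h(4) Comp_Hom[OF sesD(1,2)[OF o(1)]]] by simp
  then obtain \<pi> where \<pi>: "\<pi> \<in> Hom C K\<^sub>3 Q" "\<pi> \<cdot> q = p \<cdot> y"
    using ses_colift[OF a(1) py(1)] by metis
  have "\<pi> \<in> Defl C" using deflation_factor[OF a(1) \<pi>(1)] \<pi>(2) py(2) by simp
  then obtain R \<rho> where \<rho>: "ses C R K\<^sub>3 Q \<rho> \<pi>" using deflation_ses[OF _ \<pi>(1)] by blast
  obtain T \<tau> where \<tau>: "ses C T L Q \<tau> (p \<cdot> y)" using deflation_ses[OF py(2,1)] .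
  obtain x' y' where x': "ses C K\<^sub>2 T I\<^sub>1 x' y'" "\<tau> \<cdot> x' = x" "o' \<cdot> y' = y \<cdot> \<tau>"
    using kernels_of_composite_ses[OF x(1) \<tau> o(1)] .
  obtain a' q' where a': "ses C A\<^sub>1 T R a' q'" "\<tau> \<cdot> a' = a" "\<rho> \<cdot> q' = q \<cdot> \<tau>"
    using kernels_of_composite_ses[OF a(1) _ \<rho>] \<tau> \<pi>(2) by metis
  note h = h \<pi>(1) sesD(1)[OF \<rho>] sesD(1)[OF \<tau>] sesD(1,2)[OF x'(1)] sesD(1,2)[OF a'(1)]
  have y'a': "y' \<cdot> a' = e\<^sub>1"
  proof (rule ses_mono[OF o(1)])
    show "o' \<cdot> (y' \<cdot> a') = o' \<cdot> e\<^sub>1"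
      using comp_extend[OF x'(3), where x = a'] a'(2) ya h by (simp add: comp_simps)
  qed (use h in \<open>auto intro: Comp_Hom\<close>)
  have "x' \<cdot> \<kappa>\<^sub>1 = a' \<cdot> k\<^sub>1"
    \<comment> \<open>Both sides are compared in \<open>A\<^sub>2\<close>, where they become \<open>\<phi>\<^sub>1 \<cdot> k\<^sub>1\<close>.\<close>
  proof (rule ses_mono[OF \<tau>], rule_tac [3] ses_mono[OF l])
    show "l \<cdot> (\<tau> \<cdot> (x' \<cdot> \<kappa>\<^sub>1)) = l \<cdot> (\<tau> \<cdot> (a' \<cdot> k\<^sub>1))"
      using comp_extend[OF x'(2), where x = "\<kappa>\<^sub>1"] comp_extend[OF x(2), where x = "\<kappa>\<^sub>1"]
        comp_extend[OF a'(2), where x = "k\<^sub>1"] comp_extend[OF a(2), where x = "k\<^sub>1"] \<kappa>1(2) h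
      by (simp add: comp_simps)
  qed (use h in \<open>auto intro: Comp_Hom\<close>)
  then have \<kappa>s: "ses C K\<^sub>1 K\<^sub>2 R \<kappa>\<^sub>1 (q' \<cdot> x')"
    using diamond_ses[OF a'(1) x'(1) _ \<kappa>1(1)] e1 y'a' by simp
  have "\<rho> \<cdot> (q' \<cdot> x') = \<kappa>\<^sub>2"
  proof (rule ses_mono[OF e3])
    show "k\<^sub>3 \<cdot> (\<rho> \<cdot> (q' \<cdot> x')) = k\<^sub>3 \<cdot> \<kappa>\<^sub>2"
      using comp_extend[OF a'(3), where x = x'] comp_extend[OF a(3), where x = x]
        x'(2) x(2) \<kappa>2(2) h by (simp add: comp_simps)
  qed (use h in \<open>auto intro: Comp_Hom\<close>)
  then show ?thesis
    using that l sesD(4)[OF a(1)] sesD(2)[OF a(1)] a(3) sesD(2)[OF x(1)] x(3) \<kappa>s \<rho> \<pi>(2) by blast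
qed

section \<open>The connecting morphism\<close>

lemma column_index:
  "(1::nat) \<in> {1, 2, 3}" "(2::nat) \<in> {1, 2, 3}" "(3::nat) \<in> {1, 2, 3}"
  by simp_all

text \<open>The diagram rewritten with explicit objects. The arrows \<open>coker_arr D i\<close>, given only as
  cokernels, are here recognized as deflations.\<close>

lemma snakeD:
  assumes "snake C D"
  shows "ses C (Dom C (vert D 1)) (Dom C (vert D 2)) (Dom C (vert D 3)) (top_row D 1) (top_row D 2)"
      (is ?top)
    and "ses C (Cod C (vert D 1)) (Cod C (vert D 2)) (Cod C (vert D 3)) (bottom_row D 1) (bottom_row D 2)"
      (is ?bottom)
    and "\<And>i. i \<in> {1, 2, 3} \<Longrightarrow>
      ses C (Dom C (ker_arr D i)) (Dom C (vert D i)) (Cod C (defl_part D i)) (ker_arr D i) (defl_part D i)"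
      (is "\<And>i. _ \<Longrightarrow> ?ker i")
    and "\<And>i. i \<in> {1, 2, 3} \<Longrightarrow>
      ses C (Cod C (defl_part D i)) (Cod C (vert D i)) (Cod C (coker_arr D i)) (infl_part D i) (coker_arr D i)"
      (is "\<And>i. _ \<Longrightarrow> ?coker i")
    and "\<And>i. i \<in> {1, 2, 3} \<Longrightarrow> vert D i = infl_part D i \<cdot> defl_part D i"
    and "bottom_row D 1 \<cdot> vert D 1 = vert D 2 \<cdot> top_row D 1"
    and "bottom_row D 2 \<cdot> vert D 2 = vert D 3 \<cdot> top_row D 2"
proof -
  have sq: "comm_square C (top_row D 1) (vert D 1) (vert D 2) (bottom_row D 1)"
      "comm_square C (top_row D 2) (vert D 2) (vert D 3) (bottom_row D 2)"
    and rows: "short_exact C (top_row D 1) (top_row D 2)" "short_exact C (bottom_row D 1) (bottom_row D 2)"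
    and cols: "\<And>i. i \<in> {1, 2, 3} \<Longrightarrow>
      defl_part D i \<in> Defl C \<and> inflation C (infl_part D i) \<and>
      Cod C (defl_part D i) = Dom C (infl_part D i) \<and>
      vert D i = infl_part D i \<cdot> defl_part D i \<and>
      is_kernel C (ker_arr D i) (defl_part D i) \<and>
      is_cokernel C (coker_arr D i) (infl_part D i)"
    using assms unfolding snake_def by blast+
  show ?top ?bottom
    using ses_of_short_exact[OF rows(1)] ses_of_short_exact[OF rows(2)] sq
    by (simp_all add: comm_square_def)
  show "bottom_row D 1 \<cdot> vert D 1 = vert D 2 \<cdot> top_row D 1"
    "bottom_row D 2 \<cdot> vert D 2 = vert D 3 \<cdot> top_row D 2"
    using sq by (simp_all add: comm_square_def)
  fix i :: nat assume i: "i \<in> {1, 2, 3}"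
  note c = cols[OF i]
  show fact: "vert D i = infl_part D i \<cdot> defl_part D i" using c by blast
  have h: "defl_part D i \<in> Hom C (Dom C (defl_part D i)) (Cod C (defl_part D i))"
    "infl_part D i \<in> Hom C (Cod C (defl_part D i)) (Cod C (infl_part D i))"
    "coker_arr D i \<in> Hom C (Cod C (infl_part D i)) (Cod C (coker_arr D i))"
    using c is_kernelD(2)[of "ker_arr D i" "defl_part D i"]
      is_cokernelD(1,2)[of "coker_arr D i" "infl_part D i"] by simp_all
  have v: "Dom C (vert D i) = Dom C (defl_part D i)" "Cod C (vert D i) = Cod C (infl_part D i)"
    using HomD(2,3)[OF Comp_Hom[OF h(1,2)]] by (simp_all add: fact)
  show "?ker i"
    unfolding v using ses_of_short_exact[of "ker_arr D i" "defl_part D i"] c by (simp add: short_exact_def)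
  show "?coker i" unfolding v using cokernel_of_inflation_ses[OF _ _ h(2,3)] c by simp
qed

end

text \<open>The classical recipe for the connecting morphism: restrict to the part \<open>L\<close> of \<open>A\<^sub>2\<close> that
  lies over \<open>K\<^sub>3\<close>, apply \<open>f\<^sub>2\<close>, land in \<open>B\<^sub>1\<close> and project to \<open>C\<^sub>1\<close>. The auxiliary arrows are
  existentially quantified; being a kernel and a factorization through a monomorphism, \<open>l\<close> and
  \<open>w\<close> are determined up to isomorphism, and the epimorphism \<open>q\<close> then pins down \<open>\<delta>\<close>.\<close>

definition connecting ::
  "('o, 'm, 'z) deflation_category_scheme \<Rightarrow> 'm snake_diagram \<Rightarrow> 'm \<Rightarrow> bool"
  where "connecting C D \<delta> \<longleftrightarrow>
    \<delta> \<in> Hom C (Dom C (ker_arr D 3)) (Cod C (coker_arr D 1)) \<and>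
    (\<exists>l q w. is_kernel C l (defl_part D 3 \<cdot>\<^bsub>C\<^esub> top_row D 2) \<and>
      q \<in> Defl C \<and> q \<in> Hom C (Dom C l) (Dom C (ker_arr D 3)) \<and>
      w \<in> Hom C (Dom C l) (Cod C (vert D 1)) \<and>
      ker_arr D 3 \<cdot>\<^bsub>C\<^esub> q = top_row D 2 \<cdot>\<^bsub>C\<^esub> l \<and>
      bottom_row D 1 \<cdot>\<^bsub>C\<^esub> w = vert D 2 \<cdot>\<^bsub>C\<^esub> l \<and>
      \<delta> \<cdot>\<^bsub>C\<^esub> q = coker_arr D 1 \<cdot>\<^bsub>C\<^esub> w)"

context weakly_exact_category
begin

text \<open>The sequence starts with the monomorphism \<open>\<kappa>\<^sub>1\<close> and ends with the deflation \<open>\<gamma>\<^sub>2\<close>, so its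
  chain of short exact sequences is completed by \<open>0 \<rightarrow> K\<^sub>1 = K\<^sub>1\<close> and \<open>C\<^sub>3 = C\<^sub>3 \<rightarrow> 0\<close>.\<close>

lemma exact_sequence_snakeI:
  assumes \<kappa>: "ses C K\<^sub>1 K\<^sub>2 R \<kappa>\<^sub>1 s" and \<rho>: "ses C R K\<^sub>3 Q \<rho> \<pi>"
    and z: "ses C Q C\<^sub>1 N z i" and n: "ses C N C\<^sub>2 C\<^sub>3 n \<gamma>\<^sub>2"
  shows "exact_sequence C [K\<^sub>1, K\<^sub>2, K\<^sub>3, C\<^sub>1, C\<^sub>2, C\<^sub>3] [\<kappa>\<^sub>1, \<rho> \<cdot> s, z \<cdot> \<pi>, n \<cdot> i, \<gamma>\<^sub>2]"
proof -
  obtain O' where O': "zero_object C O'" using zero_object_exists by blast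
  have ob: "K\<^sub>1 \<in> Obj C" "C\<^sub>3 \<in> Obj C" using HomD[OF sesD(1)[OF \<kappa>]] HomD[OF sesD(2)[OF n]] by auto
  obtain a b where ab: "a \<in> Hom C O' K\<^sub>1" "b \<in> Hom C C\<^sub>3 O'"
    using zero_object_unique[OF O'] ob by metis
  have ses: "ses C ([O', K\<^sub>1, R, Q, N, C\<^sub>3, O'] ! j) ([K\<^sub>1, K\<^sub>2, K\<^sub>3, C\<^sub>1, C\<^sub>2, C\<^sub>3] ! j)
      ([O', K\<^sub>1, R, Q, N, C\<^sub>3, O'] ! Suc j)
      ([a, \<kappa>\<^sub>1, \<rho>, z, n, Id C C\<^sub>3] ! j) ([Id C K\<^sub>1, s, \<pi>, i, \<gamma>\<^sub>2, b] ! j)" if "j < 6" for j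
  proof -
    consider "j = 0" | "j = 1" | "j = 2" | "j = 3" | "j = 4" | "j = 5" using \<open>j < 6\<close> by linarith
    then show ?thesis
      using ses_zero_Id[OF O' ab(1)] \<kappa> \<rho> z n ses_Id_zero[OF O' ab(2)]
      by cases (simp_all add: eval_nat_numeral)
  qed
  have comp: "[\<kappa>\<^sub>1, \<rho> \<cdot> s, z \<cdot> \<pi>, n \<cdot> i, \<gamma>\<^sub>2] ! j =
      [a, \<kappa>\<^sub>1, \<rho>, z, n, Id C C\<^sub>3] ! Suc j \<cdot> [Id C K\<^sub>1, s, \<pi>, i, \<gamma>\<^sub>2, b] ! j" if "j < 5" for j
  proof -
    consider "j = 0" | "j = 1" | "j = 2" | "j = 3" | "j = 4" using \<open>j < 5\<close> by linarith
    then show ?thesis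
      using Comp_Id_right[OF sesD(1)[OF \<kappa>]] Comp_Id_left[OF sesD(2)[OF n]]
      by cases (simp_all add: eval_nat_numeral)
  qed
  show ?thesis
    unfolding exact_sequence_def
    using ses comp
    by (intro conjI exI[of _ "\<lambda>j. [O', K\<^sub>1, R, Q, N, C\<^sub>3, O'] ! j"]
        exI[of _ "\<lambda>j. [a, \<kappa>\<^sub>1, \<rho>, z, n, Id C C\<^sub>3] ! j"]
        exI[of _ "\<lambda>j. [Id C K\<^sub>1, s, \<pi>, i, \<gamma>\<^sub>2, b] ! j"])
      (simp_all add: ses_def)
qed

lemma snake_exact:
  assumes D: "snake C D"
  obtains \<delta> where "connecting C D \<delta>"
    "exact_sequence C
        [Dom C (ker_arr D 1), Dom C (ker_arr D 2), Dom C (ker_arr D 3),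
         Cod C (coker_arr D 1), Cod C (coker_arr D 2), Cod C (coker_arr D 3)]
        [snake_psi C D 1, snake_psi C D 2, \<delta>, snake_psi' C D 1, snake_psi' C D 2]"
    "inflation C (snake_psi C D 1)" "snake_psi' C D 2 \<in> Defl C"
proof -
  note top = snakeD(1)[OF D] and bottom = snakeD(2)[OF D]
  note k1 = snakeD(3)[OF D column_index(1)] and k2 = snakeD(3)[OF D column_index(2)]
    and k3 = snakeD(3)[OF D column_index(3)]
  note c1 = snakeD(4)[OF D column_index(1)] and c2 = snakeD(4)[OF D column_index(2)]
    and c3 = snakeD(4)[OF D column_index(3)]
  note v = snakeD(5)[OF D column_index(1)] snakeD(5)[OF D column_index(2)]
    snakeD(5)[OF D column_index(3)]
  note sq = snakeD(6,7)[OF D, unfolded v]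
  obtain \<kappa>\<^sub>1 r\<^sub>1 \<gamma>\<^sub>1 where 1:
    "\<kappa>\<^sub>1 \<in> Hom C (Dom C (ker_arr D 1)) (Dom C (ker_arr D 2))"
    "ker_arr D 2 \<cdot> \<kappa>\<^sub>1 = top_row D 1 \<cdot> ker_arr D 1"
    "r\<^sub>1 \<in> Hom C (Cod C (defl_part D 1)) (Cod C (defl_part D 2))"
    "r\<^sub>1 \<cdot> defl_part D 1 = defl_part D 2 \<cdot> top_row D 1"
    "infl_part D 2 \<cdot> r\<^sub>1 = bottom_row D 1 \<cdot> infl_part D 1"
    "\<gamma>\<^sub>1 \<in> Hom C (Cod C (coker_arr D 1)) (Cod C (coker_arr D 2))"
    "\<gamma>\<^sub>1 \<cdot> coker_arr D 1 = coker_arr D 2 \<cdot> bottom_row D 1"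
    using induced_morphisms[OF k1 c1 k2 c2 sesD(1)[OF top] sesD(1)[OF bottom] sq(1)] .
  obtain \<kappa>\<^sub>2 r\<^sub>2 \<gamma>\<^sub>2 where 2:
    "\<kappa>\<^sub>2 \<in> Hom C (Dom C (ker_arr D 2)) (Dom C (ker_arr D 3))"
    "ker_arr D 3 \<cdot> \<kappa>\<^sub>2 = top_row D 2 \<cdot> ker_arr D 2"
    "r\<^sub>2 \<in> Hom C (Cod C (defl_part D 2)) (Cod C (defl_part D 3))"
    "r\<^sub>2 \<cdot> defl_part D 2 = defl_part D 3 \<cdot> top_row D 2"
    "infl_part D 3 \<cdot> r\<^sub>2 = bottom_row D 2 \<cdot> infl_part D 2"
    "\<gamma>\<^sub>2 \<in> Hom C (Cod C (coker_arr D 2)) (Cod C (coker_arr D 3))"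
    "\<gamma>\<^sub>2 \<cdot> coker_arr D 2 = coker_arr D 3 \<cdot> bottom_row D 2"
    using induced_morphisms[OF k2 c2 k3 c3 sesD(2)[OF top] sesD(2)[OF bottom] sq(2)] .
  have "defl_part D 3 \<cdot> top_row D 2 \<in> Defl C"
    using Defl_Comp[OF sesD(4)[OF top] sesD(4)[OF k3]] HomD(3)[OF sesD(2)[OF top]]
      HomD(2)[OF sesD(2)[OF k3]] by simp
  then have "r\<^sub>2 \<in> Defl C" using deflation_factor[OF k2 2(3)] 2(4) by simp
  then obtain J j where j: "ses C J (Cod C (defl_part D 2)) (Cod C (defl_part D 3)) j r\<^sub>2"
    using deflation_ses[OF _ 2(3)] by blast
  obtain Q N d o' p z i n where B:
    "d \<in> Hom C J (Cod C (vert D 1))" "bottom_row D 1 \<cdot> d = infl_part D 2 \<cdot> j"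
    "ses C (Cod C (defl_part D 1)) J Q o' p" "j \<cdot> o' = r\<^sub>1"
    "ses C Q (Cod C (coker_arr D 1)) N z i" "z \<cdot> p = coker_arr D 1 \<cdot> d"
    "ses C N (Cod C (coker_arr D 2)) (Cod C (coker_arr D 3)) n \<gamma>\<^sub>2" "n \<cdot> i = \<gamma>\<^sub>1"
    using cokernel_side[OF bottom c1 c2 c3 1(3,5) j 2(5) 1(6,7) 2(6,7)] .
  obtain L R l q y s \<rho> \<pi> where A:
    "ses C L (Dom C (vert D 2)) (Cod C (defl_part D 3)) l (defl_part D 3 \<cdot> top_row D 2)"
    "q \<in> Defl C" "q \<in> Hom C L (Dom C (ker_arr D 3))" "ker_arr D 3 \<cdot> q = top_row D 2 \<cdot> l"
    "y \<in> Hom C L J" "j \<cdot> y = defl_part D 2 \<cdot> l"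
    "ses C (Dom C (ker_arr D 1)) (Dom C (ker_arr D 2)) R \<kappa>\<^sub>1 s"
    "ses C R (Dom C (ker_arr D 3)) Q \<rho> \<pi>" "\<rho> \<cdot> s = \<kappa>\<^sub>2" "\<pi> \<cdot> q = p \<cdot> y"
    using kernel_side[OF top k1 k2 k3 1(4) j 2(4) B(3,4) 1(1,2) 2(1,2)] .
  have psi: "snake_psi C D 1 = \<kappa>\<^sub>1" "snake_psi C D 2 = \<kappa>\<^sub>2"
    using ker_map_eq[OF k2 sesD(1)[OF k1] 1(1,2)] ker_map_eq[OF k3 sesD(1)[OF k2] 2(1,2)]
    by (simp_all add: snake_psi_def eval_nat_numeral)
  have psi': "snake_psi' C D 1 = \<gamma>\<^sub>1" "snake_psi' C D 2 = \<gamma>\<^sub>2"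
    using coker_map_eq[OF c1 sesD(2)[OF c2] 1(6,7)] coker_map_eq[OF c2 sesD(2)[OF c3] 2(6,7)]
    by (simp_all add: snake_psi'_def eval_nat_numeral)
  have h: "l \<in> Hom C L (Dom C (vert D 2))" "z \<in> Hom C Q (Cod C (coker_arr D 1))"
    "\<pi> \<in> Hom C (Dom C (ker_arr D 3)) Q" "p \<in> Hom C J Q"
    "j \<in> Hom C J (Cod C (defl_part D 2))"
    using sesD(1)[OF A(1)] sesD(1)[OF B(5)] sesD(2)[OF A(8)] sesD(2)[OF B(3)] sesD(1)[OF j] by auto
  note h = h A(3,5) B(1) sesD(1)[OF bottom] sesD(1,2)[OF c2] sesD(2)[OF c1] sesD(2)[OF k2]
  have "bottom_row D 1 \<cdot> (d \<cdot> y) = (infl_part D 2 \<cdot> defl_part D 2) \<cdot> l"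
    using comp_extend[OF B(2), where x = y] A(6) h by (simp add: comp_simps)
  then have "bottom_row D 1 \<cdot> (d \<cdot> y) = vert D 2 \<cdot> l" by (simp only: v)
  moreover have "(z \<cdot> \<pi>) \<cdot> q = coker_arr D 1 \<cdot> (d \<cdot> y)"
    using comp_extend[OF B(6), where x = y] A(10) h by (simp add: comp_simps)
  moreover have "z \<cdot> \<pi> \<in> Hom C (Dom C (ker_arr D 3)) (Cod C (coker_arr D 1))"
    "d \<cdot> y \<in> Hom C L (Cod C (vert D 1))"
    using Comp_Hom h by blast+
  moreover have "Dom C l = L" using HomD(2)[OF h(1)] .
  ultimately have "connecting C D (z \<cdot> \<pi>)"
    unfolding connecting_def using A(2-4) ses_is_kernel[OF A(1)] by metis
  moreover have "inflation C \<kappa>\<^sub>1"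
    unfolding inflation_def using sesD(4)[OF A(7)] ses_is_kernel[OF A(7)] by blast
  ultimately show ?thesis
    using that exact_sequence_snakeI[OF A(7,8) B(5,7)] sesD(4)[OF B(7)]
    unfolding psi psi' A(9) B(8) by blast
qed

text \<open>The kernel property of \<open>l'\<close> provides a morphism \<open>\<theta>\<close> from \<open>L\<close> to \<open>L'\<close> over \<open>a 2\<close>.
  It is compatible with the arrows to \<open>K\<^sub>3\<close> and to \<open>B\<^sub>1\<close>, as can be tested after the monomorphisms
  into \<open>A'\<^sub>3\<close> and \<open>B'\<^sub>2\<close>. So the two composites agree on \<open>L\<close>, and \<open>L \<rightarrow> K\<^sub>3\<close> is epi.\<close>

lemma connecting_natural:
  assumes D: "snake C D" and D': "snake C D'" and ab: "snake_morphism C D D' a b"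
    and \<delta>: "connecting C D \<delta>" and \<delta>': "connecting C D' \<delta>'"
  shows "coker_map C (coker_arr D 1) (coker_arr D' 1) (b 1) \<cdot> \<delta> =
    \<delta>' \<cdot> ker_map C (ker_arr D 3) (ker_arr D' 3) (a 3)"
proof -
  have sq: "\<And>i. i \<in> {1, 2} \<Longrightarrow> comm_square C (top_row D i) (a i) (a (Suc i)) (top_row D' i)"
    "\<And>i. i \<in> {1, 2} \<Longrightarrow> comm_square C (bottom_row D i) (b i) (b (Suc i)) (bottom_row D' i)"
    "\<And>i. i \<in> {1, 2, 3} \<Longrightarrow> comm_square C (vert D i) (a i) (b i) (vert D' i)"
    using ab unfolding snake_morphism_def by blast+
  have a: "a i \<in> Hom C (Dom C (vert D i)) (Dom C (vert D' i))"
    and b: "b i \<in> Hom C (Cod C (vert D i)) (Cod C (vert D' i))"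
    and sqv: "b i \<cdot> vert D i = vert D' i \<cdot> a i" if "i \<in> {1, 2, 3}" for i
    using sq(3)[OF that] by (simp_all add: comm_square_def Hom_def)
  have sqt: "a 3 \<cdot> top_row D 2 = top_row D' 2 \<cdot> a 2"
    and sqb: "b 2 \<cdot> bottom_row D 1 = bottom_row D' 1 \<cdot> b 1"
    using sq(1)[of 2] sq(2)[of 1] by (simp_all add: comm_square_def eval_nat_numeral)
  note top = snakeD(1)[OF D] and bottom = snakeD(2)[OF D]
    and top' = snakeD(1)[OF D'] and bottom' = snakeD(2)[OF D']
  note k3 = snakeD(3)[OF D column_index(3)] and k1 = snakeD(3)[OF D column_index(1)]
    and c3 = snakeD(4)[OF D column_index(3)] and c1 = snakeD(4)[OF D column_index(1)]
    and k3' = snakeD(3)[OF D' column_index(3)] and k1' = snakeD(3)[OF D' column_index(1)]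
    and c3' = snakeD(4)[OF D' column_index(3)] and c1' = snakeD(4)[OF D' column_index(1)]
  have sq3: "b 3 \<cdot> (infl_part D 3 \<cdot> defl_part D 3) = (infl_part D' 3 \<cdot> defl_part D' 3) \<cdot> a 3"
    and sq1: "b 1 \<cdot> (infl_part D 1 \<cdot> defl_part D 1) = (infl_part D' 1 \<cdot> defl_part D' 1) \<cdot> a 1"
    using sqv[OF column_index(3)] sqv[OF column_index(1)] snakeD(5)[OF D column_index(3)] snakeD(5)[OF D column_index(1)]
      snakeD(5)[OF D' column_index(3)] snakeD(5)[OF D' column_index(1)] by simp_all
  obtain \<kappa> r where \<kappa>: "\<kappa> \<in> Hom C (Dom C (ker_arr D 3)) (Dom C (ker_arr D' 3))"
    "ker_arr D' 3 \<cdot> \<kappa> = a 3 \<cdot> ker_arr D 3"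
    and r: "r \<in> Hom C (Cod C (defl_part D 3)) (Cod C (defl_part D' 3))"
    "r \<cdot> defl_part D 3 = defl_part D' 3 \<cdot> a 3"
    using induced_morphisms[OF k3 c3 k3' c3' a[OF column_index(3)] b[OF column_index(3)] sq3] by metis
  obtain \<gamma> where \<gamma>: "\<gamma> \<in> Hom C (Cod C (coker_arr D 1)) (Cod C (coker_arr D' 1))"
    "\<gamma> \<cdot> coker_arr D 1 = coker_arr D' 1 \<cdot> b 1"
    using induced_morphisms[OF k1 c1 k1' c1' a[OF column_index(1)] b[OF column_index(1)] sq1] by metis
  have maps: "ker_map C (ker_arr D 3) (ker_arr D' 3) (a 3) = \<kappa>"
    "coker_map C (coker_arr D 1) (coker_arr D' 1) (b 1) = \<gamma>"
    using ker_map_eq[OF k3' sesD(1)[OF k3] \<kappa>] coker_map_eq[OF c1 sesD(2)[OF c1'] \<gamma>] by auto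
  have d: "\<delta> \<in> Hom C (Dom C (ker_arr D 3)) (Cod C (coker_arr D 1))"
    "\<delta>' \<in> Hom C (Dom C (ker_arr D' 3)) (Cod C (coker_arr D' 1))"
    using \<delta> \<delta>' by (simp_all add: connecting_def)
  obtain l q w where l: "is_kernel C l (defl_part D 3 \<cdot> top_row D 2)"
    and q: "q \<in> Defl C" "q \<in> Hom C (Dom C l) (Dom C (ker_arr D 3))"
      "ker_arr D 3 \<cdot> q = top_row D 2 \<cdot> l"
    and w: "w \<in> Hom C (Dom C l) (Cod C (vert D 1))" "bottom_row D 1 \<cdot> w = vert D 2 \<cdot> l"
    and \<delta>q: "\<delta> \<cdot> q = coker_arr D 1 \<cdot> w"
    using \<delta> unfolding connecting_def by blast
  obtain l' q' w' where l': "is_kernel C l' (defl_part D' 3 \<cdot> top_row D' 2)"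
    and q': "q' \<in> Hom C (Dom C l') (Dom C (ker_arr D' 3))"
      "ker_arr D' 3 \<cdot> q' = top_row D' 2 \<cdot> l'"
    and w': "w' \<in> Hom C (Dom C l') (Cod C (vert D' 1))" "bottom_row D' 1 \<cdot> w' = vert D' 2 \<cdot> l'"
    and \<delta>q': "\<delta>' \<cdot> q' = coker_arr D' 1 \<cdot> w'"
    using \<delta>' unfolding connecting_def by blast
  note a2 = a[OF column_index(2)] and a3 = a[OF column_index(3)]
    and b1 = b[OF column_index(1)] and b2 = b[OF column_index(2)]
  have f: "defl_part D 3 \<cdot> top_row D 2 \<in> Hom C (Dom C (vert D 2)) (Cod C (defl_part D 3))"
    "defl_part D' 3 \<cdot> top_row D' 2 \<in> Hom C (Dom C (vert D' 2)) (Cod C (defl_part D' 3))"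
    using Comp_Hom[OF sesD(2)[OF top] sesD(2)[OF k3]] Comp_Hom[OF sesD(2)[OF top'] sesD(2)[OF k3']] by auto
  have lH: "l \<in> Hom C (Dom C l) (Dom C (vert D 2))" "l' \<in> Hom C (Dom C l') (Dom C (vert D' 2))"
    using is_kernelD(1)[OF l] is_kernelD(1)[OF l'] HomD(2)[OF f(1)] HomD(2)[OF f(2)] by auto
  have vH: "vert D 2 \<in> Hom C (Dom C (vert D 2)) (Cod C (vert D 2))"
    "vert D' 2 \<in> Hom C (Dom C (vert D' 2)) (Cod C (vert D' 2))"
    using sq(3)[OF column_index(2)] by (simp_all add: comm_square_def Hom_def)
  note h = a2 a3 b1 b2 lH vH q(2) q'(1) w(1) w'(1) \<kappa>(1) \<gamma>(1) r(1) d
    sesD(1,2)[OF top] sesD(1,2)[OF top'] sesD(1,2)[OF bottom] sesD(1,2)[OF bottom']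
    sesD(1,2)[OF k3] sesD(1,2)[OF k3'] sesD(1,2)[OF c1] sesD(1,2)[OF c1']
  have "(defl_part D' 3 \<cdot> top_row D' 2) \<cdot> (a 2 \<cdot> l) = r \<cdot> ((defl_part D 3 \<cdot> top_row D 2) \<cdot> l)"
  proof -
    have "r \<cdot> ((defl_part D 3 \<cdot> top_row D 2) \<cdot> l) = (defl_part D' 3 \<cdot> a 3) \<cdot> (top_row D 2 \<cdot> l)"
      unfolding r(2)[symmetric] using h by (simp add: comp_simps)
    also have "\<dots> = defl_part D' 3 \<cdot> ((a 3 \<cdot> top_row D 2) \<cdot> l)"
      using h by (simp add: comp_simps)
    also have "\<dots> = (defl_part D' 3 \<cdot> top_row D' 2) \<cdot> (a 2 \<cdot> l)"
      unfolding sqt using h by (simp add: comp_simps)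
    finally show ?thesis ..
  qed
  then have "zero_morphism C ((defl_part D' 3 \<cdot> top_row D' 2) \<cdot> (a 2 \<cdot> l))"
    using zero_comp_right[OF is_kernelD(3)[OF l] Comp_Hom[OF lH(1) f(1)] r(1)] by simp
  then obtain \<theta> where \<theta>: "\<theta> \<in> Hom C (Dom C l) (Dom C l')" "l' \<cdot> \<theta> = a 2 \<cdot> l"
    using is_kernel_lift[OF l' lH(2) f(2) Comp_Hom[OF lH(1) a2]] by blast
  note h = h \<theta>(1)
  have q\<theta>: "q' \<cdot> \<theta> = \<kappa> \<cdot> q"
  proof (rule ses_mono[OF k3'])
    have "ker_arr D' 3 \<cdot> (q' \<cdot> \<theta>) = (ker_arr D' 3 \<cdot> q') \<cdot> \<theta>" using h by (simp add: comp_simps)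
    also have "\<dots> = top_row D' 2 \<cdot> (l' \<cdot> \<theta>)" unfolding q'(2) using h by (simp add: comp_simps)
    also have "\<dots> = (top_row D' 2 \<cdot> a 2) \<cdot> l" unfolding \<theta>(2) using h by (simp add: comp_simps)
    also have "\<dots> = a 3 \<cdot> (top_row D 2 \<cdot> l)" unfolding sqt[symmetric] using h by (simp add: comp_simps)
    also have "\<dots> = (a 3 \<cdot> ker_arr D 3) \<cdot> q" unfolding q(3)[symmetric] using h by (simp add: comp_simps)
    also have "\<dots> = ker_arr D' 3 \<cdot> (\<kappa> \<cdot> q)" unfolding \<kappa>(2)[symmetric] using h by (simp add: comp_simps)
    finally show "ker_arr D' 3 \<cdot> (q' \<cdot> \<theta>) = ker_arr D' 3 \<cdot> (\<kappa> \<cdot> q)" .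
  qed (use h in \<open>auto intro: Comp_Hom\<close>)
  have w\<theta>: "w' \<cdot> \<theta> = b 1 \<cdot> w"
  proof (rule ses_mono[OF bottom'])
    have "bottom_row D' 1 \<cdot> (w' \<cdot> \<theta>) = (bottom_row D' 1 \<cdot> w') \<cdot> \<theta>" using h by (simp add: comp_simps)
    also have "\<dots> = vert D' 2 \<cdot> (l' \<cdot> \<theta>)" unfolding w'(2) using h by (simp add: comp_simps)
    also have "\<dots> = (vert D' 2 \<cdot> a 2) \<cdot> l" unfolding \<theta>(2) using h by (simp add: comp_simps)
    also have "\<dots> = b 2 \<cdot> (vert D 2 \<cdot> l)" using sqv[OF column_index(2), symmetric] h by (simp add: comp_simps)
    also have "\<dots> = (b 2 \<cdot> bottom_row D 1) \<cdot> w" unfolding w(2)[symmetric] using h by (simp add: comp_simps)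
    also have "\<dots> = bottom_row D' 1 \<cdot> (b 1 \<cdot> w)" unfolding sqb using h by (simp add: comp_simps)
    finally show "bottom_row D' 1 \<cdot> (w' \<cdot> \<theta>) = bottom_row D' 1 \<cdot> (b 1 \<cdot> w)" .
  qed (use h in \<open>auto intro: Comp_Hom\<close>)
  obtain X x where x: "ses C X (Dom C l) (Dom C (ker_arr D 3)) x q" using deflation_ses[OF q(1,2)] .
  have "\<gamma> \<cdot> \<delta> = \<delta>' \<cdot> \<kappa>"
  proof (rule ses_epi[OF x])
    have "(\<gamma> \<cdot> \<delta>) \<cdot> q = \<gamma> \<cdot> (\<delta> \<cdot> q)" using h by (simp add: comp_simps)
    also have "\<dots> = (\<gamma> \<cdot> coker_arr D 1) \<cdot> w" unfolding \<delta>q using h by (simp add: comp_simps)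
    also have "\<dots> = coker_arr D' 1 \<cdot> (b 1 \<cdot> w)" unfolding \<gamma>(2) using h by (simp add: comp_simps)
    also have "\<dots> = (coker_arr D' 1 \<cdot> w') \<cdot> \<theta>" unfolding w\<theta>[symmetric] using h by (simp add: comp_simps)
    also have "\<dots> = \<delta>' \<cdot> (q' \<cdot> \<theta>)" unfolding \<delta>q'[symmetric] using h by (simp add: comp_simps)
    also have "\<dots> = (\<delta>' \<cdot> \<kappa>) \<cdot> q" unfolding q\<theta> using h by (simp add: comp_simps)
    finally show "(\<gamma> \<cdot> \<delta>) \<cdot> q = (\<delta>' \<cdot> \<kappa>) \<cdot> q" .
  qed (use h in \<open>auto intro: Comp_Hom\<close>)
  then show ?thesis unfolding maps .
qed

end

theorem theorem3p1:
  fixes C :: "('o, 'm) deflation_category"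
  assumes "weakly_exact_category C"
  shows "\<exists>\<delta> :: 'm snake_diagram \<Rightarrow> 'm.
    (\<forall>D. snake C D \<longrightarrow>
      \<delta> D \<in> Hom C (Dom C (ker_arr D 3)) (Cod C (coker_arr D 1)) \<and>
      exact_sequence C
        [Dom C (ker_arr D 1), Dom C (ker_arr D 2), Dom C (ker_arr D 3),
         Cod C (coker_arr D 1), Cod C (coker_arr D 2), Cod C (coker_arr D 3)]
        [snake_psi C D 1, snake_psi C D 2, \<delta> D, snake_psi' C D 1, snake_psi' C D 2] \<and>
      inflation C (snake_psi C D 1) \<and>
      snake_psi' C D 2 \<in> Defl C) \<and>
    (\<forall>D D' a b. snake C D \<and> snake C D' \<and> snake_morphism C D D' a b \<longrightarrow>
      coker_map C (coker_arr D 1) (coker_arr D' 1) (b 1) \<cdot>\<^bsub>C\<^esub> \<delta> D =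
      \<delta> D' \<cdot>\<^bsub>C\<^esub> ker_map C (ker_arr D 3) (ker_arr D' 3) (a 3))"
proof -
  interpret weakly_exact_category C by (rule assms)
  let ?exact = "\<lambda>D \<delta>. exact_sequence C
        [Dom C (ker_arr D 1), Dom C (ker_arr D 2), Dom C (ker_arr D 3),
         Cod C (coker_arr D 1), Cod C (coker_arr D 2), Cod C (coker_arr D 3)]
        [snake_psi C D 1, snake_psi C D 2, \<delta>, snake_psi' C D 1, snake_psi' C D 2] \<and>
      inflation C (snake_psi C D 1) \<and> snake_psi' C D 2 \<in> Defl C"
  have "\<forall>D. \<exists>\<delta>. snake C D \<longrightarrow> connecting C D \<delta> \<and> ?exact D \<delta>"
    using snake_exact by meson
  then obtain \<delta> where \<delta>: "\<And>D. snake C D \<Longrightarrow> connecting C D (\<delta> D) \<and> ?exact D (\<delta> D)"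
    using choice[of "\<lambda>D \<delta>. snake C D \<longrightarrow> connecting C D \<delta> \<and> ?exact D \<delta>"] by blast
  have "\<delta> D \<in> Hom C (Dom C (ker_arr D 3)) (Cod C (coker_arr D 1)) \<and> ?exact D (\<delta> D)" if "snake C D" for D
    using \<delta>[OF that] unfolding connecting_def by (elim conjE) (intro conjI)
  moreover have "coker_map C (coker_arr D 1) (coker_arr D' 1) (b 1) \<cdot>\<^bsub>C\<^esub> \<delta> D =
      \<delta> D' \<cdot>\<^bsub>C\<^esub> ker_map C (ker_arr D 3) (ker_arr D' 3) (a 3)"
    if "snake C D \<and> snake C D' \<and> snake_morphism C D D' a b" for D D' a b
    using connecting_natural[of D D' a b "\<delta> D" "\<delta> D'"] \<delta>[of D] \<delta>[of D'] that by (elim conjE) simp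
  ultimately show ?thesis
    by (intro exI[of _ \<delta>] conjI[OF allI allI] allI impI)
qed

end
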